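(* The set $\mathrm{SS}_0(\mathbb{R})$ of all strongly vanishing symmetric homeomorphisms of $\mathbb{R}$ is a group under composition.
   Context: For a bounded interval $I\subset\mathbb{R}$, $|I|$ is its length and $f_I$ the mean of $f$ over $I$. $\mathrm{BMO}(\mathbb{R})$ is the space of locally integrable $f$ on $\mathbb{R}$ with $\|f\|_*=\sup_I \frac1{|I|}\int_I|f-f_I|dx<\infty$; $\mathrm{CMO}(\mathbb{R})$ is the closure in $\mathrm{BMO}(\mathbb{R})$, with respect to $\|\cdot\|_*$, of the continuous functions with compact support (functions modulo constants). A sense-preserving homeomorphism $h$ of $\mathbb{R}$ onto itself belongs to $\mathrm{SQS}(\mathbb{R})$ if there are constants $0<C_1,C_2<\infty$ such that $|h(A)|/|h(I)|\le C_1(|A|/|I|)^{C_2}$ for all bounded intervals $I$ and all measurable $A\subset I$; such $h$ is locally absolutely continuous. $h$ is strongly vanishing symmetric, $h\in\mathrm{SS}_0(\mathbb{R})$, if $h\in\mathrm{SQS}(\mathbb{R})$ and $\log h'\in\mathrm{CMO}(\mathbb{R})$. *)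

theory Defs
  imports "HOL-Analysis.Analysis" "HOL-Algebra.Group"
begin

(* Bounded intervals are represented by {a..b} with a < b: adding or removing endpoints changes
   neither the averages below nor |h(I)|, and every set A contained in a bounded interval is
   contained in its closure, of the same length. *)

definition locally_integrable :: "(real \<Rightarrow> real) \<Rightarrow> bool" where
  "locally_integrable f \<longleftrightarrow> (\<forall>a b. set_integrable lebesgue {a..b} f)"

definition interval_mean :: "(real \<Rightarrow> real) \<Rightarrow> real \<Rightarrow> real \<Rightarrow> real" where
  "interval_mean f a b = (LINT x:{a..b}|lebesgue. f x) / (b - a)"

definition mean_oscillation :: "(real \<Rightarrow> real) \<Rightarrow> real \<Rightarrow> real \<Rightarrow> real" where
  "mean_oscillation f a b = (LINT x:{a..b}|lebesgue. \<bar>f x - interval_mean f a b\<bar>) / (b - a)"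

definition bmo_norm :: "(real \<Rightarrow> real) \<Rightarrow> ennreal" where
  "bmo_norm f = (SUP (a, b) \<in> {(a, b). a < b}. ennreal (mean_oscillation f a b))"

(* The elements of BMO and CMO are functions rather than classes modulo constants; both sets are
   closed under adding constants and under changes on null sets. *)

definition BMO :: "(real \<Rightarrow> real) set" where
  "BMO = {f. locally_integrable f \<and> bmo_norm f < \<infinity>}"

definition Cc :: "(real \<Rightarrow> real) set" where
  "Cc = {\<phi>. continuous_on UNIV \<phi> \<and> compact (closure {x. \<phi> x \<noteq> 0})}"

definition CMO :: "(real \<Rightarrow> real) set" where
  "CMO = {f \<in> BMO. \<forall>\<epsilon>>0. \<exists>\<phi>\<in>Cc. bmo_norm (\<lambda>x. f x - \<phi> x) < ennreal \<epsilon>}"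

definition sense_preserving_homeo :: "(real \<Rightarrow> real) \<Rightarrow> bool" where
  "sense_preserving_homeo h \<longleftrightarrow> strict_mono h \<and> (\<exists>k. homeomorphism UNIV UNIV h k)"

(* The measurability of h(A) is what gives |h(A)| a meaning: the library assigns measure 0 to
   non-measurable sets. It is no extra restriction, since the inequality for Borel sets A already
   makes h locally absolutely continuous. *)

definition SQS :: "(real \<Rightarrow> real) set" where
  "SQS = {h. sense_preserving_homeo h \<and>
     (\<exists>C1>0. \<exists>C2>0. \<forall>a b A. a < b \<longrightarrow> A \<in> sets lebesgue \<longrightarrow> A \<subseteq> {a..b} \<longrightarrow>
        h ` A \<in> sets lebesgue \<and>
        measure lebesgue (h ` A) / measure lebesgue (h ` {a..b})
          \<le> C1 * (measure lebesgue A / measure lebesgue {a..b}) powr C2)}"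

(* The almost-everywhere clause says that log h' is defined almost everywhere, so that the totalised
   values of deriv and ln occur only on a null set. *)

definition SS0 :: "(real \<Rightarrow> real) set" where
  "SS0 = {h \<in> SQS. (AE x in lebesgue. h field_differentiable (at x) \<and> 0 < deriv h x) \<and>
     (\<lambda>x. ln (deriv h x)) \<in> CMO}"

end

theory Submission
  imports Defs
begin

text \<open>
  Off null sets \<open>ln (g \<circ> h)' = ln g' \<circ> h + ln h'\<close>, and if \<open>k\<close> is the inverse of \<open>h\<close> then
  \<open>ln k' = - ln h' \<circ> k\<close>. Since CMO is a vector space, the group axioms follow from two facts about
  \<open>h \<in> SS0\<close> with inverse \<open>k\<close>: \<open>k\<close> belongs to SQS, and composition with \<open>h\<close> and with \<open>k\<close> maps CMO into
  itself. Both rest on the John--Nirenberg inequality (\<open>John_Nirenberg\<close>), which comes from a stopping-time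
  argument on dyadic subintervals (\<open>stopping_time_bound\<close>).

  Composition (\<open>compose_bmo\<close>, \<open>CMO_compose\<close>). On an interval \<open>I\<close>, the set where \<open>f \<circ> h\<close> is far from the mean
  of \<open>f\<close> over \<open>h(I)\<close> is the \<open>k\<close>-image of the set where \<open>f\<close> is far from that mean. The latter has
  exponentially small relative measure in \<open>h(I)\<close>, and if \<open>k\<close> is in SQS, this turns into an exponentially
  small relative measure in \<open>I\<close>. Hence \<open>f \<mapsto> f \<circ> h\<close> is bounded for the BMO norm. As it also maps compactly
  supported continuous functions to such functions, it preserves their closure CMO.

  Inverse (\<open>reverse_measure_bound\<close>, \<open>inverse_SQS_bound\<close>). Since \<open>ln h'\<close> lies in CMO, it is the sum of a bounded
  function and a function \<open>\<psi>\<close> of small BMO norm. By John--Nirenberg both \<open>exp (\<psi> - m)\<close> and \<open>exp (m - \<psi>)\<close>,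
  with \<open>m\<close> the mean of \<open>\<psi>\<close> over \<open>I\<close>, have bounded means over \<open>I\<close>, so \<open>h'\<close> is a Muckenhoupt \<open>A\<^sub>2\<close> weight.
  The Cauchy--Schwarz inequality for \<open>\<bar>A\<bar> = \<integral>\<^sub>A \<surd>h' / \<surd>h'\<close> then gives
  \<open>\<bar>A\<bar> / \<bar>I\<bar> \<le> C (\<bar>h(A)\<bar> / \<bar>h(I)\<bar>)\<^sup>1\<^sup>/\<^sup>2\<close>, which is the SQS condition for \<open>k\<close>.
\<close>

section \<open>Locally integrable functions\<close>

lemma locally_integrableD: "locally_integrable f \<Longrightarrow> set_integrable lebesgue {a..b} f"
  by (simp add: locally_integrable_def)

lemma locally_integrable_measurable:
  assumes "locally_integrable f"
  shows "f \<in> borel_measurable lebesgue"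
proof (rule borel_measurable_LIMSEQ_metric)
  show "(\<lambda>x. indicator {- real n..real n} x *\<^sub>R f x) \<in> borel_measurable lebesgue" for n
    using locally_integrableD[OF assms, of "- real n" "real n"]
    unfolding set_integrable_def by (rule borel_measurable_integrable)
  fix x :: real
  have "eventually (\<lambda>n. indicator {- real n..real n} x *\<^sub>R f x = f x) sequentially"
  proof (rule eventually_sequentiallyI)
    fix n assume "nat \<lceil>\<bar>x\<bar>\<rceil> \<le> n"
    then have "x \<in> {- real n..real n}" by (auto simp: nat_le_iff ceiling_le_iff abs_le_iff)
    then show "indicator {- real n..real n} x *\<^sub>R f x = f x" by simp
  qed
  then show "(\<lambda>n. indicator {- real n..real n} x *\<^sub>R f x) \<longlonglongrightarrow> f x"
    by (rule tendsto_eventually)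
qed

lemma locally_integrable_const: "locally_integrable (\<lambda>x. c)"
  unfolding locally_integrable_def set_integrable_def
  by (auto intro!: integrable_real_indicator integrable_scaleR_left simp: emeasure_lborel_Icc_eq)

lemma locally_integrable_add:
  "locally_integrable f \<Longrightarrow> locally_integrable g \<Longrightarrow> locally_integrable (\<lambda>x. f x + g x)"
  by (auto simp: locally_integrable_def)

lemma locally_integrable_diff:
  "locally_integrable f \<Longrightarrow> locally_integrable g \<Longrightarrow> locally_integrable (\<lambda>x. f x - g x)"
  by (auto simp: locally_integrable_def)

lemma locally_integrable_cmult:
  "locally_integrable f \<Longrightarrow> locally_integrable (\<lambda>x. c * f x)"
  by (auto simp: locally_integrable_def)

lemma locally_integrable_abs:
  "locally_integrable f \<Longrightarrow> locally_integrable (\<lambda>x. \<bar>f x\<bar>)"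
  by (auto simp: locally_integrable_def intro: set_integrable_abs)

lemma set_integral_split_Icc:
  assumes "locally_integrable f" "a \<le> b" "b \<le> c"
  shows "(LINT x:{a..c}|lebesgue. f x) = (LINT x:{a..b}|lebesgue. f x) + (LINT x:{b..c}|lebesgue. f x)"
proof -
  note i = locally_integrableD[OF assms(1)]
  show ?thesis
    using Henstock_Kurzweil_Integration.integral_combine[OF assms(2,3) set_lebesgue_integral_eq_integral(1)[OF i]]
    by (simp add: set_lebesgue_integral_eq_integral(2)[OF i])
qed

lemma set_integral_const_Icc: "a \<le> b \<Longrightarrow> (LINT x:{a..b}|lebesgue. c) = (b - a) * (c::real)"
  by (simp add: set_lebesgue_integral_def)

section \<open>Lebesgue differentiation\<close>

lemma lebesgue_point_right:
  assumes "locally_integrable g"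
  shows "AE x in lebesgue. \<forall>e>0. \<exists>d>0. \<forall>h. 0 < h \<and> h < d \<longrightarrow>
           \<bar>(LINT y:{x..x+h}|lebesgue. g y) / h - g x\<bar> < e"
proof -
  have "g integrable_on cbox a b" for a b
    using set_lebesgue_integral_eq_integral(1)[OF locally_integrableD[OF assms]] by (simp add: cbox_interval)
  then obtain N where N: "negligible N" and
    *: "\<And>x e. \<lbrakk>x \<notin> N; 0 < e\<rbrakk> \<Longrightarrow> \<exists>d>0. \<forall>h. 0 < h \<and> h < d \<longrightarrow>
        norm (integral (cbox x (x + h *\<^sub>R One)) g /\<^sub>R h ^ DIM(real) - g x) < e"
    using integrable_ccontinuous_explicit[of g] by metis
  show ?thesis
  proof (rule AE_I'[of N])
    show "N \<in> null_sets lebesgue" using N by (simp add: negligible_iff_null_sets)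
    have "\<forall>e>0. \<exists>d>0. \<forall>h. 0 < h \<and> h < d \<longrightarrow>
           \<bar>(LINT y:{x..x+h}|lebesgue. g y) / h - g x\<bar> < e" if "x \<notin> N" for x
      using *[OF that]
      by (simp add: set_lebesgue_integral_eq_integral(2)[OF locally_integrableD[OF assms]] divide_inverse mult.commute)
    then show "{x \<in> space lebesgue. \<not> (\<forall>e>0. \<exists>d>0. \<forall>h. 0 < h \<and> h < d \<longrightarrow>
           \<bar>(LINT y:{x..x+h}|lebesgue. g y) / h - g x\<bar> < e)} \<subseteq> N" by blast
  qed
qed

lemma locally_integrable_reflect:
  assumes "locally_integrable g" shows "locally_integrable (\<lambda>x. g (- x))"
  unfolding locally_integrable_def
proof safe
  fix a b
  have "g absolutely_integrable_on cbox (-b) (-a)" using locally_integrableD[OF assms] by (simp add: cbox_interval)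
  then show "(\<lambda>x. g (- x)) absolutely_integrable_on {a..b}"
    using absolutely_integrable_reflect_real[where f=g and a="-b" and b="-a"] by simp
qed

lemma set_integral_reflect:
  assumes "locally_integrable g"
  shows "(LINT x:{a..b}|lebesgue. g (- x)) = (LINT x:{-b..-a}|lebesgue. g x)"
  using set_lebesgue_integral_eq_integral(2)[OF locally_integrableD[OF assms], of "-b" "-a"]
     set_lebesgue_integral_eq_integral(2)[OF locally_integrableD[OF locally_integrable_reflect[OF assms]], of a b]
     Henstock_Kurzweil_Integration.integral_reflect_real[of "-a" "-b" g]
  by simp

lemma AE_lebesgue_reflect:
  assumes "AE x in lebesgue. P (x::real)" shows "AE x in lebesgue. P (- x)"
proof -
  obtain N where N: "negligible N" "{x. \<not> P x} \<subseteq> N"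
    using assms by (auto simp: eventually_ae_filter negligible_iff_null_sets)
  then have "negligible (uminus ` N)"
    by (intro negligible_differentiable_image_negligible)
       (auto intro!: derivative_intros simp: differentiable_on_def)
  moreover have "{x. \<not> P (- x)} \<subseteq> uminus ` N"
    using N(2) by (force simp: image_iff)
  ultimately show ?thesis
    by (auto simp: eventually_ae_filter negligible_iff_null_sets)
qed

lemma lebesgue_point_left:
  assumes "locally_integrable g"
  shows "AE x in lebesgue. \<forall>e>0. \<exists>d>0. \<forall>h. 0 < h \<and> h < d \<longrightarrow>
           \<bar>(LINT y:{x-h..x}|lebesgue. g y) / h - g x\<bar> < e"
  using AE_lebesgue_reflect[OF lebesgue_point_right[OF locally_integrable_reflect[OF assms]]]
  by (simp add: set_integral_reflect[OF assms] algebra_simps)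

text \<open>
  Almost every point is a Lebesgue point from the right and from the left. An interval around it
  splits there into two pieces, and both have means close to the value at the point.
\<close>
lemma interval_mean_near_point:
  assumes "locally_integrable g"
  shows "AE x in lebesgue. \<forall>t. t < g x \<longrightarrow> (\<exists>d>0. \<forall>c e. c < x \<and> x < e \<and> e - c < d \<longrightarrow> t < interval_mean g c e)"
  using lebesgue_point_left[OF assms] lebesgue_point_right[OF assms]
proof eventually_elim
  case (elim x)
  show ?case
  proof safe
    fix t assume t: "t < g x"
    obtain d1 where d1: "d1 > 0" "\<And>h. 0 < h \<Longrightarrow> h < d1 \<Longrightarrow> \<bar>(LINT y:{x-h..x}|lebesgue. g y) / h - g x\<bar> < g x - t"
      using elim(1) t by (metis diff_gt_0_iff_gt)
    obtain d2 where d2: "d2 > 0" "\<And>h. 0 < h \<Longrightarrow> h < d2 \<Longrightarrow> \<bar>(LINT y:{x..x+h}|lebesgue. g y) / h - g x\<bar> < g x - t"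
      using elim(2) t by (metis diff_gt_0_iff_gt)
    show "\<exists>d>0. \<forall>c e. c < x \<and> x < e \<and> e - c < d \<longrightarrow> t < interval_mean g c e"
    proof (intro exI conjI allI impI)
      show "min d1 d2 > 0" using d1 d2 by simp
      fix c e assume ce: "c < x \<and> x < e \<and> e - c < min d1 d2"
      have "t < (LINT y:{c..x}|lebesgue. g y) / (x - c)"
        using d1(2)[of "x - c"] ce by (auto simp: abs_if split: if_splits)
      then have 1: "t * (x - c) < (LINT y:{c..x}|lebesgue. g y)" using ce by (simp add: pos_less_divide_eq)
      have "t < (LINT y:{x..e}|lebesgue. g y) / (e - x)"
        using d2(2)[of "e - x"] ce by (auto simp: abs_if split: if_splits)
      then have 2: "t * (e - x) < (LINT y:{x..e}|lebesgue. g y)" using ce by (simp add: pos_less_divide_eq)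
      have "t * (e - c) < (LINT y:{c..e}|lebesgue. g y)"
        using 1 2 set_integral_split_Icc[OF assms, of c x e] ce by (simp add: algebra_simps)
      then show "t < interval_mean g c e" using ce by (simp add: interval_mean_def pos_less_divide_eq)
    qed
  qed
qed

section \<open>The John--Nirenberg inequality\<close>

lemma interval_mean_le_iff:
  "a < b \<Longrightarrow> interval_mean g a b \<le> t \<longleftrightarrow> (LINT x:{a..b}|lebesgue. g x) \<le> t * (b - a)"
  by (simp add: interval_mean_def pos_divide_le_eq)

lemma lmeasurable_Int_Icc: "X \<in> sets lebesgue \<Longrightarrow> X \<inter> {a..b::real} \<in> lmeasurable"
  by (intro bounded_set_imp_lmeasurable) auto

lemma lmeasurable_subset_Icc:
  "X \<in> sets lebesgue \<Longrightarrow> X \<subseteq> {a..b::real} \<Longrightarrow> X \<in> lmeasurable"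
  by (metis bounded_closed_interval bounded_set_imp_lmeasurable bounded_subset)

lemma level_set_measurable:
  fixes f :: "real \<Rightarrow> real"
  assumes "f \<in> borel_measurable lebesgue"
  shows "{x \<in> {a..b}. t < \<bar>f x - c\<bar>} \<in> sets lebesgue"
proof -
  have "(\<lambda>x. \<bar>f x - c\<bar>) \<in> borel_measurable lebesgue"
    using assms by (intro borel_measurable_abs borel_measurable_diff) auto
  then have "{x. t < \<bar>f x - c\<bar>} \<in> sets lebesgue"
    by (simp add: borel_measurable_iff_greater)
  then have "{x. t < \<bar>f x - c\<bar>} \<inter> {a..b} \<in> sets lebesgue" by (intro sets.Int) auto
  then show ?thesis by (simp add: Int_def conj_commute)
qed

lemma measure_Icc_split:
  fixes a b c :: real
  assumes "T \<in> sets lebesgue" "a \<le> b" "b \<le> c"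
  shows "measure lebesgue (T \<inter> {a..c}) \<le> measure lebesgue (T \<inter> {a..b}) + measure lebesgue (T \<inter> {b..c})"
proof -
  have "T \<inter> {a..c} = (T \<inter> {a..b}) \<union> (T \<inter> {b..c})" using assms by auto
  moreover have "T \<inter> {p..q} \<in> sets lebesgue" for p q using assms(1) by (intro sets.Int) auto
  ultimately show ?thesis by (simp add: measure_Un_le)
qed

lemma set_integral_nonneg_Icc:
  assumes "\<And>x. 0 \<le> g x" shows "0 \<le> (LINT x:{a..b}|lebesgue. g x :: real)"
  unfolding set_lebesgue_integral_def using assms by (intro integral_nonneg_AE) auto

text \<open>
  Bisect: a half of an interval of mean at most \<open>t\<close> has mean at most \<open>2 * t\<close>, so either it again
  has mean at most \<open>t\<close>, or it is stopped. On a stopped half \<open>u..v\<close> the bound \<open>\<theta> * (v - u)\<close> is at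
  most \<open>\<theta> / t\<close> times the integral of \<open>g\<close>, and these integrals add up. The induction over the
  number of bisections ends at scale \<open>\<delta>\<close>, where nothing of \<open>T\<close> is left.
\<close>
lemma stopping_time_bound_finite:
  fixes g :: "real \<Rightarrow> real"
  assumes g: "locally_integrable g" "\<And>x. 0 \<le> g x" and T: "T \<in> sets lebesgue" and t: "0 < t" "0 \<le> \<theta>"
    and stop: "\<And>c d. a \<le> c \<Longrightarrow> c < d \<Longrightarrow> d \<le> b \<Longrightarrow> t < interval_mean g c d \<Longrightarrow> interval_mean g c d \<le> 2 * t
        \<Longrightarrow> measure lebesgue (T \<inter> {c..d}) \<le> \<theta> * (d - c)"
    and small: "\<And>c d. c < d \<Longrightarrow> d - c < \<delta> \<Longrightarrow> interval_mean g c d \<le> t \<Longrightarrow> T \<inter> {c<..<d} = {}"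
  shows "a \<le> c \<Longrightarrow> c < d \<Longrightarrow> d \<le> b \<Longrightarrow> interval_mean g c d \<le> t \<Longrightarrow> d - c < \<delta> * 2 ^ m \<Longrightarrow>
    measure lebesgue (T \<inter> {c..d}) \<le> \<theta> / t * (LINT x:{c..d}|lebesgue. g x)"
proof (induction m arbitrary: c d)
  case 0
  then have "T \<inter> {c<..<d} = {}" by (intro small) auto
  then have "T \<inter> {c..d} \<subseteq> {c, d}" by force
  then have "measure lebesgue (T \<inter> {c..d}) = 0"
    by (meson finite.emptyI finite.insertI finite_subset negligible_finite negligible_imp_measure0)
  then show ?case using t set_integral_nonneg_Icc[of g, OF g(2)] by simp
next
  case (Suc m)
  define p where "p = (c + d) / 2"
  have p: "c < p" "p < d" "p - c = (d - c) / 2" "d - p = (d - c) / 2" using Suc.prems by (auto simp: p_def field_simps)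
  note sp = set_integral_split_Icc[OF g(1), of c p d]
  have half: "measure lebesgue (T \<inter> {u..v}) \<le> \<theta> / t * (LINT x:{u..v}|lebesgue. g x)"
    if "a \<le> u" "u < v" "v \<le> b" "v - u = (d - c) / 2"
      "(LINT x:{u..v}|lebesgue. g x) \<le> (LINT x:{c..d}|lebesgue. g x)" for u v
  proof (cases "interval_mean g u v \<le> t")
    case True
    then show ?thesis using that Suc by (intro Suc.IH) auto
  next
    case False
    have "(LINT x:{u..v}|lebesgue. g x) \<le> t * (d - c)"
      using that Suc.prems by (simp add: interval_mean_le_iff)
    also have "t * (d - c) = 2 * t * (v - u)" unfolding that(4) by simp
    finally have "interval_mean g u v \<le> 2 * t" unfolding interval_mean_le_iff[OF that(2)] .
    then have "measure lebesgue (T \<inter> {u..v}) \<le> \<theta> * (v - u)"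
      using False that by (intro stop) auto
    moreover have "t * (v - u) \<le> (LINT x:{u..v}|lebesgue. g x)"
      using False unfolding interval_mean_le_iff[OF that(2)] by simp
    then have "\<theta> / t * (t * (v - u)) \<le> \<theta> / t * (LINT x:{u..v}|lebesgue. g x)"
      using t by (intro mult_left_mono) auto
    then have "\<theta> * (v - u) \<le> \<theta> / t * (LINT x:{u..v}|lebesgue. g x)"
      using t by simp
    ultimately show ?thesis by linarith
  qed
  have "measure lebesgue (T \<inter> {c..p}) \<le> \<theta> / t * (LINT x:{c..p}|lebesgue. g x)"
    using p Suc.prems sp set_integral_nonneg_Icc[of g, OF g(2), of p d] by (intro half) auto
  moreover have "measure lebesgue (T \<inter> {p..d}) \<le> \<theta> / t * (LINT x:{p..d}|lebesgue. g x)"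
    using p Suc.prems sp set_integral_nonneg_Icc[of g, OF g(2), of c p] by (intro half) auto
  ultimately show ?case
    using measure_Icc_split[OF T, of c p d] p sp by (simp add: distrib_left)
qed

text \<open>
  The Calderon--Zygmund decomposition in integrated form. By the Lebesgue differentiation theorem,
  almost every point of \<open>S\<close> lies in no sufficiently short interval of mean at most \<open>t\<close>. So \<open>S\<close> is,
  up to a null set, the increasing union of sets to which the finite version applies.
\<close>
lemma stopping_time_bound:
  fixes g :: "real \<Rightarrow> real"
  assumes g: "locally_integrable g" "\<And>x. 0 \<le> g x" and S: "S \<in> sets lebesgue" "\<And>x. x \<in> S \<Longrightarrow> t < g x"
    and t: "0 < t" "0 \<le> \<theta>"
    and stop: "\<And>c d. a \<le> c \<Longrightarrow> c < d \<Longrightarrow> d \<le> b \<Longrightarrow> t < interval_mean g c d \<Longrightarrow> interval_mean g c d \<le> 2 * t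
        \<Longrightarrow> measure lebesgue (S \<inter> {c..d}) \<le> \<theta> * (d - c)"
    and ab: "a < b" "interval_mean g a b \<le> t"
  shows "measure lebesgue (S \<inter> {a..b}) \<le> \<theta> / t * (LINT x:{a..b}|lebesgue. g x)"
proof -
  \<comment> \<open>Taking open intervals makes \<open>B \<delta>\<close> open, hence measurable.\<close>
  define B where "B \<delta> = (\<Union>(c, d) \<in> {(c, d). c < d \<and> d - c < \<delta> \<and> interval_mean g c d \<le> t}. {c<..<d})" for \<delta>
  define Bad where "Bad j = B (1 / real (Suc j))" for j
  define T where "T j = (S - Bad j) \<inter> {a..b}" for j
  have "open (Bad j)" for j unfolding Bad_def B_def by auto
  then have SB: "S - Bad j \<in> sets lebesgue" for j
    using S(1) by (simp add: borel_open sets_completionI_sets sets.Diff)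
  then have Tm: "T j \<in> sets lebesgue" for j unfolding T_def by (intro sets.Int) auto
  have bound: "measure lebesgue (T j) \<le> \<theta> / t * (LINT x:{a..b}|lebesgue. g x)" for j
  proof -
    obtain m where m: "(b - a) * real (Suc j) < 2 ^ m" using real_arch_pow[of 2] by auto
    have "measure lebesgue ((S - Bad j) \<inter> {c..d}) \<le> \<theta> * (d - c)"
      if "a \<le> c" "c < d" "d \<le> b" "t < interval_mean g c d" "interval_mean g c d \<le> 2 * t" for c d
    proof -
      have "measure lebesgue ((S - Bad j) \<inter> {c..d}) \<le> measure lebesgue (S \<inter> {c..d})"
        using SB S(1) by (intro measure_mono_fmeasurable lmeasurable_Int_Icc) (auto intro: sets.Int)
      then show ?thesis using stop[OF that] by linarith
    qed
    moreover have "(S - Bad j) \<inter> {c<..<d} = {}" if "c < d" "d - c < 1 / real (Suc j)" "interval_mean g c d \<le> t" for c d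
      using that unfolding Bad_def B_def by blast
    ultimately show ?thesis unfolding T_def
      by (rule stopping_time_bound_finite[OF g SB t, where m = m and \<delta> = "1 / real (Suc j)" and b=b and a=a])
         (use ab m in \<open>auto simp: field_simps\<close>)
  qed
  have inc: "incseq T"
  proof (intro incseq_SucI subsetI)
    fix j x assume x: "x \<in> T j"
    have "B \<delta> \<subseteq> B \<delta>'" if "\<delta> \<le> \<delta>'" for \<delta> \<delta>'
      unfolding B_def using that by (intro UN_mono) auto
    then have "Bad (Suc j) \<subseteq> Bad j" unfolding Bad_def by (simp add: field_simps)
    then show "x \<in> T (Suc j)" using x by (auto simp: T_def)
  qed
  have UT: "(\<Union>j. T j) \<in> sets lebesgue" using Tm by blast
  then have U: "(\<Union>j. T j) \<in> lmeasurable"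
    by (rule lmeasurable_subset_Icc[of _ a b]) (auto simp: T_def)
  have "(\<lambda>j. measure lebesgue (T j)) \<longlonglongrightarrow> measure lebesgue (\<Union>j. T j)"
    using Tm inc U by (intro Lim_measure_incseq) (auto simp: fmeasurable_def less_top)
  then have le: "measure lebesgue (\<Union>j. T j) \<le> \<theta> / t * (LINT x:{a..b}|lebesgue. g x)"
    using bound by (intro LIMSEQ_le_const2) auto
  have "AE x in lebesgue. x \<in> S \<inter> {a..b} \<longleftrightarrow> x \<in> (\<Union>j. T j)"
    using interval_mean_near_point[OF g(1)]
  proof eventually_elim
    case (elim x)
    have "\<exists>j. x \<notin> Bad j" if xS: "x \<in> S"
    proof -
      obtain e where e: "e > 0" "\<And>c d. c < x \<Longrightarrow> x < d \<Longrightarrow> d - c < e \<Longrightarrow> t < interval_mean g c d"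
        using elim S(2)[OF xS] by blast
      obtain j where "1 / real (Suc j) < e" using e(1) by (metis nat_approx_posE)
      then show ?thesis using e(2) unfolding Bad_def B_def by (intro exI[of _ j]) fastforce
    qed
    then show ?case by (auto simp: T_def)
  qed
  then have "measure lebesgue (S \<inter> {a..b}) = measure lebesgue (\<Union>j. T j)"
    using S(1) UT by (intro measure_eq_AE sets.Int) auto
  then show ?thesis using le by simp
qed

lemma bmo_norm_le_iff:
  "0 \<le> B \<Longrightarrow> bmo_norm f \<le> ennreal B \<longleftrightarrow> (\<forall>a b. a < b \<longrightarrow> mean_oscillation f a b \<le> B)"
  by (auto simp: bmo_norm_def SUP_le_iff ennreal_le_iff)

lemma mean_oscillation_eq_mean:
  "mean_oscillation f a b = interval_mean (\<lambda>x. \<bar>f x - interval_mean f a b\<bar>) a b"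
  by (simp add: mean_oscillation_def interval_mean_def)

lemma interval_mean_diff_const:
  assumes "locally_integrable f" "a < b"
  shows "interval_mean (\<lambda>x. f x - c) a b = interval_mean f a b - c"
proof -
  have "(LINT x:{a..b}|lebesgue. f x - c) = (LINT x:{a..b}|lebesgue. f x) - (LINT x:{a..b}|lebesgue. c)"
    using assms(1) locally_integrable_const[of c] by (intro set_integral_diff) (auto simp: locally_integrable_def)
  then show ?thesis using assms(2)
    by (simp add: interval_mean_def set_integral_const_Icc diff_divide_distrib)
qed

lemma abs_interval_mean_le:
  assumes "locally_integrable f" "a < b"
  shows "\<bar>interval_mean f a b\<bar> \<le> interval_mean (\<lambda>x. \<bar>f x\<bar>) a b"
proof -
  have "\<bar>LINT x:{a..b}|lebesgue. f x\<bar> \<le> (LINT x:{a..b}|lebesgue. \<bar>f x\<bar>)"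
    using set_integral_norm_bound[OF locally_integrableD[OF assms(1)]] by simp
  then show ?thesis using assms(2) by (simp add: interval_mean_def divide_right_mono)
qed

text \<open>
  Put \<open>g = \<bar>f - m\<bar>\<close> with \<open>m\<close> the mean of \<open>f\<close> over the interval, and stop at level 2. On a stopped
  subinterval the mean of \<open>g\<close> is at most 4, so there the mean of \<open>f\<close> has moved by at most 4, and a
  deviation above \<open>4 * (n + 1)\<close> from the old mean exceeds \<open>4 * n\<close> from the new one. The induction
  hypothesis on the stopped subintervals, of total length at most half of the whole, yields the
  factor \<open>1 / 2\<close>.
\<close>
lemma John_Nirenberg:
  assumes f: "locally_integrable f" "bmo_norm f \<le> 1" and ab: "a < b"
  shows "measure lebesgue {x \<in> {a..b}. 4 * real n < \<bar>f x - interval_mean f a b\<bar>} \<le> (1 / 2) ^ n * (b - a)"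
  using ab
proof (induction n arbitrary: a b)
  case 0
  have "measure lebesgue {x \<in> {a..b}. 4 * real 0 < \<bar>f x - interval_mean f a b\<bar>} \<le> measure lebesgue {a..b}"
    using locally_integrable_measurable[OF f(1)]
    by (intro measure_mono_fmeasurable level_set_measurable) auto
  then show ?case using 0 by simp
next
  case (Suc n)
  have fm: "f \<in> borel_measurable lebesgue" using f(1) by (rule locally_integrable_measurable)
  have osc: "mean_oscillation f c d \<le> 1" if "c < d" for c d
    using f(2) bmo_norm_le_iff[of 1 f] that by simp
  define g where "g x = \<bar>f x - interval_mean f a b\<bar>" for x
  define S where "S = {x. 4 * real (Suc n) < g x}"
  have dli: "locally_integrable (\<lambda>x. f x - c)" for c
    using f(1) locally_integrable_const by (rule locally_integrable_diff)
  have gli: "locally_integrable g" unfolding g_def using dli by (rule locally_integrable_abs)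
  have Sm: "S \<in> sets lebesgue"
    using locally_integrable_measurable[OF gli] by (simp add: S_def borel_measurable_iff_greater)
  have mean: "interval_mean g a b \<le> 1"
    using osc[OF Suc.prems] by (simp add: mean_oscillation_eq_mean g_def[abs_def])
  have "measure lebesgue (S \<inter> {a..b}) \<le> (1 / 2) ^ n / 2 * (LINT x:{a..b}|lebesgue. g x)"
  proof (rule stopping_time_bound[OF gli _ Sm])
    fix c d assume cd: "a \<le> c" "c < d" "d \<le> b" "2 < interval_mean g c d" "interval_mean g c d \<le> 2 * 2"
    have "\<bar>interval_mean f c d - interval_mean f a b\<bar> \<le> interval_mean g c d"
      using abs_interval_mean_le[OF dli cd(2), of "interval_mean f a b"] interval_mean_diff_const[OF f(1) cd(2)]
      by (simp add: g_def[abs_def])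
    then have "S \<inter> {c..d} \<subseteq> {x \<in> {c..d}. 4 * real n < \<bar>f x - interval_mean f c d\<bar>}"
      using cd(5) by (auto simp: S_def g_def)
    then have "measure lebesgue (S \<inter> {c..d}) \<le> measure lebesgue {x \<in> {c..d}. 4 * real n < \<bar>f x - interval_mean f c d\<bar>}"
      using Sm by (intro measure_mono_fmeasurable lmeasurable_subset_Icc[of _ c d] level_set_measurable fm sets.Int) auto
    then show "measure lebesgue (S \<inter> {c..d}) \<le> (1 / 2) ^ n * (d - c)"
      using Suc.IH[OF cd(2)] by linarith
  qed (use Suc.prems mean in \<open>auto simp: S_def g_def\<close>)
  also have "\<dots> \<le> (1 / 2) ^ n / 2 * (b - a)"
    using mean Suc.prems by (intro mult_left_mono) (auto simp: interval_mean_le_iff)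
  finally have "measure lebesgue (S \<inter> {a..b}) \<le> (1 / 2) ^ Suc n * (b - a)" by simp
  moreover have "S \<inter> {a..b} = {x \<in> {a..b}. 4 * real (Suc n) < \<bar>f x - interval_mean f a b\<bar>}"
    by (auto simp: S_def g_def)
  ultimately show ?case by (simp only:)
qed

text \<open>
  The tails decay like \<open>4\<close> to the power \<open>-n\<close> while \<open>exp\<close> grows by a factor \<open>e \<le> 3\<close> per unit, so
  the layers sum to a geometric series with ratio \<open>3 / 4\<close>.
\<close>
lemma exp_moment_from_tails:
  fixes F :: "real \<Rightarrow> real"
  assumes F: "F \<in> borel_measurable lebesgue" and ab: "a \<le> b" and C: "0 \<le> C"
    and tail: "\<And>n. measure lebesgue {x \<in> {a..b}. real n < \<bar>F x\<bar>} \<le> C * (1 / 4) ^ n * (b - a)"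
  shows "(\<integral>\<^sup>+x\<in>{a..b}. ennreal (exp \<bar>F x\<bar>) \<partial>lebesgue) \<le> ennreal ((1 + 12 * C) * (b - a))"
proof -
  define E where "E n = {x \<in> {a..b}. real n < \<bar>F x\<bar>}" for n
  have Em[measurable]: "E n \<in> sets lebesgue" for n
    using level_set_measurable[OF F, of a b n 0] by (simp add: E_def)
  have pt: "ennreal (exp \<bar>F x\<bar>) * indicator {a..b} x
      \<le> indicator {a..b} x + (\<Sum>n. ennreal (3 ^ Suc n) * indicator (E n) x)" for x
  proof (cases "x \<in> {a..b} \<and> F x \<noteq> 0")
    case True
    \<comment> \<open>The last layer reached: \<open>N < \<bar>F x\<bar> \<le> N + 1\<close>.\<close>
    define N where "N = nat (\<lceil>\<bar>F x\<bar>\<rceil> - 1)"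
    have "\<lceil>\<bar>F x\<bar>\<rceil> \<ge> 1" using True by (simp add: one_le_ceiling)
    then have N: "real N < \<bar>F x\<bar>" "\<bar>F x\<bar> \<le> real (Suc N)"
      unfolding N_def by linarith+
    have "exp \<bar>F x\<bar> \<le> exp (real (Suc N))" using N by simp
    also have "\<dots> = exp 1 ^ Suc N" by (metis exp_of_nat_mult mult.right_neutral)
    also have "\<dots> \<le> 3 ^ Suc N" using exp_le by (intro power_mono) auto
    finally have "ennreal (exp \<bar>F x\<bar>) \<le> ennreal (3 ^ Suc N) * indicator (E N) x"
      using N True by (simp add: E_def ennreal_leI)
    also have "\<dots> \<le> (\<Sum>n. ennreal (3 ^ Suc n) * indicator (E n) x)"
    proof -
      define G where "G n = ennreal (3 ^ Suc n) * indicator (E n) x" for n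
      have "sum G {N} \<le> suminf G" by (rule sum_le_suminf) auto
      then have "G N \<le> suminf G" by simp
      then show ?thesis unfolding G_def .
    qed
    finally show ?thesis using True by (simp add: add_increasing)
  qed (auto simp: indicator_def)
  have le: "ennreal (3 ^ Suc n) * emeasure lebesgue (E n) \<le> ennreal (3 * C * (b - a) * (3 / 4) ^ n)" for n
  proof -
    have "emeasure lebesgue (E n) = ennreal (measure lebesgue (E n))"
      by (intro emeasure_eq_measure2 lmeasurable_subset_Icc[of _ a b] Em) (auto simp: E_def)
    also have "\<dots> \<le> ennreal (C * (1 / 4) ^ n * (b - a))" using tail[of n] by (intro ennreal_leI) (simp add: E_def)
    finally have "ennreal (3 ^ Suc n) * emeasure lebesgue (E n) \<le> ennreal (3 ^ Suc n) * ennreal (C * (1 / 4) ^ n * (b - a))"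
      by (rule mult_left_mono) simp
    also have "\<dots> = ennreal (3 * C * (b - a) * (3 / 4) ^ n)"
      using C ab by (subst ennreal_mult[symmetric]) (auto simp: power_divide)
    finally show ?thesis .
  qed
  have [measurable]: "(indicator {a..b} :: real \<Rightarrow> ennreal) \<in> borel_measurable lebesgue"
    by (intro borel_measurable_indicator) auto
  have "(\<integral>\<^sup>+x\<in>{a..b}. ennreal (exp \<bar>F x\<bar>) \<partial>lebesgue)
      \<le> (\<integral>\<^sup>+x. indicator {a..b} x + (\<Sum>n. ennreal (3 ^ Suc n) * indicator (E n) x) \<partial>lebesgue)"
    by (intro nn_integral_mono pt)
  also have "\<dots> = emeasure lebesgue {a..b} + (\<Sum>n. ennreal (3 ^ Suc n) * emeasure lebesgue (E n))"
    by (subst nn_integral_add) (auto simp: nn_integral_suminf nn_integral_cmult)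
  also have "\<dots> \<le> ennreal (b - a) + (\<Sum>n. ennreal (3 * C * (b - a) * (3 / 4) ^ n))"
    using ab by (intro add_mono suminf_le le) auto
  also have "(\<Sum>n. ennreal (3 * C * (b - a) * (3 / 4) ^ n)) = ennreal (\<Sum>n. 3 * C * (b - a) * (3 / 4) ^ n)"
    using C ab by (intro suminf_ennreal2 summable_mult summable_geometric) auto
  also have "(\<Sum>n. 3 * C * (b - a) * (3 / 4 :: real) ^ n) = 12 * C * (b - a)"
    by (subst suminf_mult) (auto simp: suminf_geometric)
  also have "ennreal (b - a) + ennreal (12 * C * (b - a)) = ennreal ((b - a) + 12 * C * (b - a))"
    using C ab by (intro ennreal_plus[symmetric] mult_nonneg_nonneg) auto
  also have "(b - a) + 12 * C * (b - a) = (1 + 12 * C) * (b - a)" by (simp add: distrib_right)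
  finally show ?thesis .
qed

lemma mean_oscillation_cmult: "mean_oscillation (\<lambda>x. c * f x) a b = \<bar>c\<bar> * mean_oscillation f a b"
proof -
  have "\<bar>c * f x - c * m\<bar> = \<bar>c\<bar> * \<bar>f x - m\<bar>" for x m by (metis abs_mult right_diff_distrib)
  then show ?thesis by (simp add: mean_oscillation_def interval_mean_def flip: times_divide_eq_right)
qed

lemma bmo_norm_cmult_le:
  assumes "bmo_norm f \<le> ennreal B" "0 \<le> B" shows "bmo_norm (\<lambda>x. c * f x) \<le> ennreal (\<bar>c\<bar> * B)"
  using assms by (auto simp: bmo_norm_le_iff mean_oscillation_cmult mult_left_mono)

text \<open>
  Rescaling \<open>f\<close> makes the rate of decay as large as desired, at the price of a small norm.
\<close>
lemma John_Nirenberg_scaled: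
  assumes f: "locally_integrable f" "bmo_norm f \<le> ennreal (1 / (8 * real p))" and p: "0 < p" and ab: "a < b"
  shows "measure lebesgue {x \<in> {a..b}. real n < \<bar>f x - interval_mean f a b\<bar>} \<le> (1 / 4) ^ (p * n) * (b - a)"
proof -
  define f' where "f' x = 8 * real p * f x" for x
  have m: "interval_mean f' a b = 8 * real p * interval_mean f a b" by (simp add: interval_mean_def f'_def[abs_def])
  have "real n < \<bar>y - z\<bar> \<longleftrightarrow> 4 * real (2 * p * n) < \<bar>8 * real p * y - 8 * real p * z\<bar>" for y z
  proof -
    have "8 * real p * y - 8 * real p * z = 8 * real p * (y - z)" by (simp only: right_diff_distrib)
    then have "\<bar>8 * real p * y - 8 * real p * z\<bar> = 8 * real p * \<bar>y - z\<bar>" by (simp add: abs_mult)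
    then show ?thesis using p by simp
  qed
  then have eq: "{x \<in> {a..b}. real n < \<bar>f x - interval_mean f a b\<bar>} = {x \<in> {a..b}. 4 * real (2 * p * n) < \<bar>f' x - interval_mean f' a b\<bar>}"
    unfolding m by (simp add: f'_def)
  have bmo: "bmo_norm f' \<le> 1"
    using bmo_norm_cmult_le[OF f(2), of "8 * real p"] p by (simp add: f'_def[abs_def])
  have "locally_integrable f'" unfolding f'_def using f(1) by (rule locally_integrable_cmult)
  from John_Nirenberg[OF this bmo ab, of "2 * p * n"]
  have "measure lebesgue {x \<in> {a..b}. real n < \<bar>f x - interval_mean f a b\<bar>} \<le> (1 / 2) ^ (2 * p * n) * (b - a)"
    unfolding eq .
  also have "(1 / 2 :: real) ^ (2 * p * n) = (1 / 4) ^ (p * n)"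
  proof -
    have "(1 / 2 :: real) ^ (2 * (p * n)) = ((1 / 2)\<^sup>2) ^ (p * n)" by (rule power_mult)
    then show ?thesis by (simp add: power2_eq_square mult.assoc)
  qed
  finally show ?thesis .
qed

lemma exp_integrability:
  assumes f: "locally_integrable f" "bmo_norm f \<le> ennreal (1 / 8)" and ab: "a < b"
  shows "(\<integral>\<^sup>+x\<in>{a..b}. ennreal (exp \<bar>f x - interval_mean f a b\<bar>) \<partial>lebesgue) \<le> ennreal (13 * (b - a))"
proof -
  have "f \<in> borel_measurable lebesgue" using f(1) by (rule locally_integrable_measurable)
  then have meas: "(\<lambda>x. f x - interval_mean f a b) \<in> borel_measurable lebesgue"
    by (intro borel_measurable_diff) auto
  have tail: "measure lebesgue {x \<in> {a..b}. real n < \<bar>f x - interval_mean f a b\<bar>} \<le> 1 * (1 / 4) ^ n * (b - a)" for n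
  proof -
    have "bmo_norm f \<le> ennreal (1 / (8 * real 1))" using f(2) by simp
    from John_Nirenberg_scaled[OF f(1) this zero_less_one ab, of n] show ?thesis unfolding mult_1 .
  qed
  have "(\<integral>\<^sup>+x\<in>{a..b}. ennreal (exp \<bar>f x - interval_mean f a b\<bar>) \<partial>lebesgue) \<le> ennreal ((1 + 12 * 1) * (b - a))"
    by (rule exp_moment_from_tails[OF meas less_imp_le[OF ab] zero_le_one tail])
  then show ?thesis by simp
qed

lemma mean_oscillation_le_deviation:
  assumes "locally_integrable f" "a < b"
  shows "mean_oscillation f a b \<le> 2 * interval_mean (\<lambda>x. \<bar>f x - c\<bar>) a b"
proof -
  have li: "locally_integrable (\<lambda>x. f x - k)" for k
    using assms(1) locally_integrable_const by (rule locally_integrable_diff)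
  note li2 = locally_integrableD[OF locally_integrable_abs[OF li]] locally_integrableD[OF locally_integrable_const]
  have m: "\<bar>c - interval_mean f a b\<bar> \<le> interval_mean (\<lambda>x. \<bar>f x - c\<bar>) a b"
    using abs_interval_mean_le[OF li assms(2), of c] interval_mean_diff_const[OF assms] by (simp add: abs_minus_commute)
  define k where "k = \<bar>c - interval_mean f a b\<bar>"
  define P where "P = (LINT x:{a..b}|lebesgue. \<bar>f x - c\<bar>)"
  have "(LINT x:{a..b}|lebesgue. \<bar>f x - interval_mean f a b\<bar>) \<le> (LINT x:{a..b}|lebesgue. \<bar>f x - c\<bar> + k)"
    by (intro set_integral_mono set_integral_add li2) (auto simp: k_def)
  also have "\<dots> = P + (b - a) * k"
    using assms by (subst set_integral_add) (auto intro: li2 simp: set_integral_const_Icc P_def)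
  finally have "mean_oscillation f a b \<le> (P + (b - a) * k) / (b - a)"
    using assms(2) unfolding mean_oscillation_def by (intro divide_right_mono) auto
  also have "\<dots> = P / (b - a) + k" using assms(2) by (simp add: add_divide_distrib)
  finally have "mean_oscillation f a b \<le> interval_mean (\<lambda>x. \<bar>f x - c\<bar>) a b + \<bar>c - interval_mean f a b\<bar>"
    by (simp only: P_def k_def interval_mean_def)
  then show ?thesis using m by linarith
qed

section \<open>Strongly quasisymmetric homeomorphisms and their action on BMO\<close>

text \<open>
  Carrying the inverse \<open>k\<close> explicitly makes every statement about \<open>h\<close> available for its inverse by
  symmetry.
\<close>
definition homeo_pair :: "(real \<Rightarrow> real) \<Rightarrow> (real \<Rightarrow> real) \<Rightarrow> bool" where
  "homeo_pair h k \<longleftrightarrow> strict_mono h \<and> strict_mono k \<and> continuous_on UNIV h \<and> continuous_on UNIV k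
     \<and> (\<forall>x. h (k x) = x) \<and> (\<forall>x. k (h x) = x)"

text \<open>
  The SQS condition with its constants exposed and the positive denominator \<open>\<bar>h(I)\<bar> = h b - h a\<close>
  cleared.
\<close>
definition SQS_bound :: "(real \<Rightarrow> real) \<Rightarrow> real \<Rightarrow> real \<Rightarrow> bool" where
  "SQS_bound h C1 C2 \<longleftrightarrow> 0 < C1 \<and> 0 < C2 \<and>
     (\<forall>a b A. a < b \<longrightarrow> A \<in> sets lebesgue \<longrightarrow> A \<subseteq> {a..b} \<longrightarrow> h ` A \<in> sets lebesgue \<and>
        measure lebesgue (h ` A) \<le> C1 * (measure lebesgue A / (b - a)) powr C2 * (h b - h a))"

lemma homeo_pair_sym: "homeo_pair h k \<Longrightarrow> homeo_pair k h"
  by (simp add: homeo_pair_def)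

lemma homeo_pair_inv: "homeo_pair h k \<Longrightarrow> h (k x) = x" "homeo_pair h k \<Longrightarrow> k (h x) = x"
  by (simp_all add: homeo_pair_def)

lemma homeo_pair_less: "homeo_pair h k \<Longrightarrow> h x < h y \<longleftrightarrow> x < y"
  by (simp add: homeo_pair_def strict_mono_less)

lemma homeo_pair_le: "homeo_pair h k \<Longrightarrow> h x \<le> h y \<longleftrightarrow> x \<le> y"
  by (simp add: homeo_pair_def strict_mono_less_eq)

lemma homeo_pair_image:
  assumes "homeo_pair h k" shows "h ` {x. P x} = {y. P (k y)}"
proof (intro subset_antisym subsetI)
  fix y assume "y \<in> {y. P (k y)}"
  then show "y \<in> h ` {x. P x}" by (intro image_eqI[of _ _ "k y"]) (auto simp: homeo_pair_inv[OF assms])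
qed (auto simp: homeo_pair_inv[OF assms])

lemma homeo_pair_image_Icc:
  assumes "homeo_pair h k" shows "h ` {a..b} = {h a..h b}"
proof -
  have "a \<le> k y \<longleftrightarrow> h a \<le> y" "k y \<le> b \<longleftrightarrow> y \<le> h b" for y
    using homeo_pair_le[OF assms, of a "k y"] homeo_pair_le[OF assms, of "k y" b]
    by (simp_all add: homeo_pair_inv[OF assms])
  then show ?thesis
    using homeo_pair_image[OF assms, of "\<lambda>x. a \<le> x \<and> x \<le> b"] by (simp add: atLeastAtMost_def atLeast_def atMost_def Int_def)
qed

lemma homeo_pair_exists:
  assumes "sense_preserving_homeo h" shows "\<exists>k. homeo_pair h k"
proof -
  obtain k where k: "homeomorphism UNIV UNIV h k" "strict_mono h" using assms by (auto simp: sense_preserving_homeo_def)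
  then have inv: "h (k x) = x" "k (h x) = x" for x by (auto simp: homeomorphism_def)
  have "strict_mono k"
    by (rule strict_monoI) (metis inv(1) k(2) strict_mono_less)
  then show ?thesis using k inv by (auto simp: homeo_pair_def homeomorphism_def)
qed

lemma homeo_pair_homeo:
  assumes "homeo_pair h k" shows "sense_preserving_homeo h"
proof -
  have "range h = UNIV" "range k = UNIV"
    using homeo_pair_image[OF assms, of "\<lambda>_. True"] homeo_pair_image[OF homeo_pair_sym[OF assms], of "\<lambda>_. True"]
    by simp_all
  then show ?thesis
    using assms unfolding sense_preserving_homeo_def homeomorphism_def homeo_pair_def by (intro conjI exI[of _ k]) auto
qed

lemma SQS_iff:
  assumes "homeo_pair h k" shows "h \<in> SQS \<longleftrightarrow> (\<exists>C1 C2. SQS_bound h C1 C2)"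
proof -
  have "measure lebesgue (h ` A) / measure lebesgue (h ` {a..b}) \<le> C1 * (measure lebesgue A / measure lebesgue {a..b}) powr C2
    \<longleftrightarrow> measure lebesgue (h ` A) \<le> C1 * (measure lebesgue A / (b - a)) powr C2 * (h b - h a)" if "a < b" for a b A C1 C2
  proof -
    have "h a < h b" using homeo_pair_less[OF assms] that by simp
    then show ?thesis using that by (simp add: homeo_pair_image_Icc[OF assms] pos_divide_le_eq)
  qed
  then show ?thesis
    unfolding SQS_def SQS_bound_def using homeo_pair_homeo[OF assms] by (simp cong: conj_cong imp_cong)
qed

lemma SQS_bound_sets:
  assumes "SQS_bound h C1 C2" "A \<in> sets lebesgue"
  shows "h ` A \<in> sets lebesgue"
proof -
  have "h ` (A \<inter> {- real (Suc n)..real (Suc n)}) \<in> sets lebesgue" for n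
  proof -
    have "A \<inter> {- real (Suc n)..real (Suc n)} \<in> sets lebesgue" using assms(2) by (intro sets.Int) auto
    moreover have "- real (Suc n) < real (Suc n)" by simp
    ultimately show ?thesis using assms(1) unfolding SQS_bound_def by blast
  qed
  then have "(\<Union>n. h ` (A \<inter> {- real (Suc n)..real (Suc n)})) \<in> sets lebesgue" by blast
  moreover have "\<exists>n. x \<in> {- real (Suc n)..real (Suc n)}" for x :: real
  proof -
    obtain n where "\<bar>x\<bar> < real n" using reals_Archimedean2 by blast
    then show ?thesis by (intro exI[of _ n]) auto
  qed
  then have "(\<Union>n. h ` (A \<inter> {- real (Suc n)..real (Suc n)})) = h ` A" by blast
  ultimately show ?thesis by simp
qed

lemma SQS_bound_null_sets:
  assumes hk: "homeo_pair h k" and bd: "SQS_bound h C1 C2" and N: "N \<in> null_sets lebesgue"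
  shows "h ` N \<in> null_sets lebesgue"
proof -
  define I where "I n = N \<inter> {- real (Suc n)..real (Suc n)}" for n
  have null: "h ` I n \<in> null_sets lebesgue" for n
  proof -
    have I: "I n \<in> null_sets lebesgue" unfolding I_def using N by (intro null_set_Int2) auto
    then have s: "I n \<in> sets lebesgue" and m: "measure lebesgue (I n) = 0" by (auto simp: measure_def)
    have sub: "I n \<subseteq> {- real (Suc n)..real (Suc n)}" and lt: "- real (Suc n) < real (Suc n)" by (auto simp: I_def)
    have "measure lebesgue (h ` I n) \<le> C1 * (measure lebesgue (I n) / (real (Suc n) - - real (Suc n))) powr C2
        * (h (real (Suc n)) - h (- real (Suc n)))"
      using bd s sub lt unfolding SQS_bound_def by blast
    then have "measure lebesgue (h ` I n) = 0" using m by (simp add: order_antisym)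
    moreover have "h ` I n \<subseteq> {h (- real (Suc n))..h (real (Suc n))}"
      using image_mono[OF sub, of h] homeo_pair_image_Icc[OF hk] by simp
    then have "h ` I n \<in> lmeasurable" using SQS_bound_sets[OF bd s] by (rule lmeasurable_subset_Icc[rotated])
    ultimately show ?thesis by (simp add: negligible_iff_measure flip: negligible_iff_null_sets)
  qed
  then have "(\<Union>n. h ` I n) \<in> null_sets lebesgue" by (rule null_sets_UN)
  moreover have "\<exists>n. x \<in> {- real (Suc n)..real (Suc n)}" for x :: real
  proof -
    obtain n where "\<bar>x\<bar> < real n" using reals_Archimedean2 by blast
    then show ?thesis by (intro exI[of _ n]) auto
  qed
  then have "(\<Union>n. h ` I n) = h ` N" unfolding I_def by blast
  ultimately show ?thesis by simp
qed

text \<open>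
  A homeomorphism alone need not pull Lebesgue measurable functions back to such functions. Here
  it does, because the preimages under \<open>h\<close> are images under \<open>k\<close>.
\<close>
lemma homeo_compose_measurable:
  assumes hk: "homeo_pair h k" and bd: "SQS_bound k C1 C2" and f: "f \<in> borel_measurable lebesgue"
  shows "(\<lambda>x. f (h x) :: real) \<in> borel_measurable lebesgue"
proof (rule borel_measurableI)
  fix U :: "real set" assume "open U"
  then have "f -` U \<inter> space lebesgue \<in> sets lebesgue" using f by (intro measurable_sets) auto
  then have "k ` (f -` U) \<in> sets lebesgue" by (intro SQS_bound_sets[OF bd]) simp
  moreover have "k ` (f -` U) = (\<lambda>x. f (h x)) -` U"
    using homeo_pair_image[OF homeo_pair_sym[OF hk], of "\<lambda>y. f y \<in> U"] by (simp add: vimage_def)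
  ultimately show "(\<lambda>x. f (h x)) -` U \<inter> space lebesgue \<in> sets lebesgue" by simp
qed

lemma integral_from_exp_moment:
  fixes F :: "real \<Rightarrow> real"
  assumes F: "F \<in> borel_measurable lebesgue"
    and M: "(\<integral>\<^sup>+x\<in>{a..b}. ennreal (exp \<bar>F x\<bar>) \<partial>lebesgue) \<le> ennreal M" "0 \<le> M"
  shows "set_integrable lebesgue {a..b} F" "(LINT x:{a..b}|lebesgue. \<bar>F x\<bar>) \<le> M"
proof -
  define G where "G x = indicator {a..b} x *\<^sub>R F x" for x
  have Gm: "G \<in> borel_measurable lebesgue"
    unfolding G_def using F by (intro borel_measurable_scaleR borel_measurable_indicator) auto
  have exp_ge: "y \<le> exp y" for y :: real using exp_ge_add_one_self[of y] by linarith
  have "(\<integral>\<^sup>+x. ennreal (norm (G x)) \<partial>lebesgue) \<le> (\<integral>\<^sup>+x\<in>{a..b}. ennreal (exp \<bar>F x\<bar>) \<partial>lebesgue)"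
    by (intro nn_integral_mono) (auto simp: G_def indicator_def exp_ge intro!: ennreal_leI)
  then have le: "(\<integral>\<^sup>+x. ennreal (norm (G x)) \<partial>lebesgue) \<le> ennreal M" by (rule order_trans[OF _ M(1)])
  then have int: "integrable lebesgue G" using Gm
    by (intro integrableI_bounded) (auto simp: order_le_less_trans[OF _ ennreal_less_top])
  then show "set_integrable lebesgue {a..b} F" by (simp add: set_integrable_def G_def[abs_def])
  have "ennreal (LINT x|lebesgue. norm (G x)) \<le> ennreal M"
    using le int by (subst nn_integral_eq_integral[symmetric]) auto
  then have "(LINT x|lebesgue. norm (G x)) \<le> M" using M(2) by simp
  moreover have "norm (G x) = indicator {a..b} x *\<^sub>R \<bar>F x\<bar>" for x by (simp add: G_def abs_mult)
  ultimately show "(LINT x:{a..b}|lebesgue. \<bar>F x\<bar>) \<le> M" by (simp add: set_lebesgue_integral_def)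
qed

text \<open>
  The tail of \<open>f\<close> on \<open>h(I)\<close> decays like \<open>4\<close> to the power \<open>- p n\<close>. The exponent \<open>C2\<close> of \<open>k\<close> weakens
  this to \<open>- p C2 n\<close>, which is at most \<open>- n\<close>, enough for the exponential moment.
\<close>
lemma compose_small_bmo:
  assumes hk: "homeo_pair h k" and bd: "SQS_bound k C1 C2" and p: "0 < p" "1 \<le> real p * C2"
    and f: "locally_integrable f" "bmo_norm f \<le> ennreal (1 / (8 * real p))"
  shows "locally_integrable (\<lambda>x. f (h x))" "bmo_norm (\<lambda>x. f (h x)) \<le> ennreal (2 * (1 + 12 * C1))"
proof -
  have C: "0 < C1" "0 < C2" using bd by (auto simp: SQS_bound_def)
  have fm: "f \<in> borel_measurable lebesgue" using f(1) by (rule locally_integrable_measurable)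
  have fhm: "(\<lambda>x. f (h x)) \<in> borel_measurable lebesgue" using hk bd fm by (rule homeo_compose_measurable)
  define m where "m a b = interval_mean f (h a) (h b)" for a b
  have Fm: "(\<lambda>x. f (h x) - m a b) \<in> borel_measurable lebesgue" for a b
    using fhm by (intro borel_measurable_diff) auto
  have tail: "measure lebesgue {x \<in> {a..b}. real n < \<bar>f (h x) - m a b\<bar>} \<le> C1 * (1 / 4) ^ n * (b - a)"
    if ab: "a < b" for a b n
  proof -
    define E where "E = {y \<in> {h a..h b}. real n < \<bar>f y - m a b\<bar>}"
    have hab: "h a < h b" using homeo_pair_less[OF hk] ab by simp
    have Em: "E \<in> sets lebesgue" unfolding E_def by (rule level_set_measurable[OF fm])
    have "E \<subseteq> {h a..h b}" by (auto simp: E_def)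
    then have "measure lebesgue (k ` E) \<le> C1 * (measure lebesgue E / (h b - h a)) powr C2 * (k (h b) - k (h a))"
      using bd Em hab unfolding SQS_bound_def by blast
    also have "k (h b) - k (h a) = b - a" by (simp add: homeo_pair_inv[OF hk])
    finally have 1: "measure lebesgue (k ` E) \<le> C1 * (measure lebesgue E / (h b - h a)) powr C2 * (b - a)" .
    have "measure lebesgue E \<le> (1 / 4) ^ (p * n) * (h b - h a)"
      unfolding E_def m_def by (rule John_Nirenberg_scaled[OF f p(1) hab])
    then have "measure lebesgue E / (h b - h a) \<le> (1 / 4) ^ (p * n)" using hab by (simp add: pos_divide_le_eq)
    then have "(measure lebesgue E / (h b - h a)) powr C2 \<le> ((1 / 4) ^ (p * n)) powr C2"
      using C hab by (intro powr_mono2) auto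
    also have "((1 / 4) ^ (p * n)) powr C2 = (1 / 4) powr (real n * (real p * C2))"
      by (simp add: powr_powr mult_ac flip: powr_realpow)
    also have "\<dots> \<le> (1 / 4) powr (real n)"
      using p(2) mult_left_mono[OF p(2), of "real n"] by (intro powr_mono') auto
    also have "\<dots> = (1 / 4) ^ n" by (simp add: powr_realpow)
    finally have 2: "(measure lebesgue E / (h b - h a)) powr C2 \<le> (1 / 4) ^ n" .
    have "k ` E = {x \<in> {a..b}. real n < \<bar>f (h x) - m a b\<bar>}"
      unfolding E_def homeo_pair_image[OF homeo_pair_sym[OF hk]] by (simp add: homeo_pair_le[OF hk])
    moreover have "C1 * (measure lebesgue E / (h b - h a)) powr C2 * (b - a) \<le> C1 * (1 / 4) ^ n * (b - a)"
      using 2 C ab by (intro mult_right_mono mult_left_mono) auto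
    ultimately show ?thesis using 1 by simp
  qed
  have mom: "(\<integral>\<^sup>+x\<in>{a..b}. ennreal (exp \<bar>f (h x) - m a b\<bar>) \<partial>lebesgue) \<le> ennreal ((1 + 12 * C1) * (b - a))"
    if "a < b" for a b
    by (rule exp_moment_from_tails[OF Fm less_imp_le[OF that] less_imp_le[OF C(1)] tail[OF that]])
  note int = integral_from_exp_moment[OF Fm mom]
  have "set_integrable lebesgue {a..b} (\<lambda>x. f (h x))" for a b
  proof (cases "a < b")
    case True
    have "set_integrable lebesgue {a..b} (\<lambda>x. f (h x) - m a b)" using True C by (intro int(1)) auto
    then have "set_integrable lebesgue {a..b} (\<lambda>x. (f (h x) - m a b) + m a b)"
      using locally_integrableD[OF locally_integrable_const] by (rule set_integral_add(1))
    then show ?thesis by simp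
  next
    case False
    then have "negligible {a..b}" by (cases "a = b") auto
    then have "{a..b} \<in> null_sets lebesgue" by (simp add: negligible_iff_null_sets)
    then have "AE x in lebesgue. x \<notin> {a..b}" by (rule AE_not_in)
    then have "AE x in lebesgue. indicator {a..b} x *\<^sub>R f (h x) = 0"
      by eventually_elim simp
    moreover have "(\<lambda>x. indicator {a..b} x *\<^sub>R f (h x)) \<in> borel_measurable lebesgue"
      using fhm by (intro borel_measurable_scaleR borel_measurable_indicator) auto
    ultimately show ?thesis unfolding set_integrable_def
      using integrable_cong_AE[of "\<lambda>x. indicator {a..b} x *\<^sub>R f (h x)" lebesgue "\<lambda>x. 0"] by simp
  qed
  then show li: "locally_integrable (\<lambda>x. f (h x))" by (simp add: locally_integrable_def)
  have "mean_oscillation (\<lambda>x. f (h x)) a b \<le> 2 * (1 + 12 * C1)" if ab: "a < b" for a b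
  proof -
    have "(LINT x:{a..b}|lebesgue. \<bar>f (h x) - m a b\<bar>) \<le> (1 + 12 * C1) * (b - a)"
      using ab C by (intro int(2)) auto
    then have "interval_mean (\<lambda>x. \<bar>f (h x) - m a b\<bar>) a b \<le> 1 + 12 * C1"
      by (simp only: interval_mean_le_iff[OF ab])
    then have "2 * interval_mean (\<lambda>x. \<bar>f (h x) - m a b\<bar>) a b \<le> 2 * (1 + 12 * C1)" by simp
    with mean_oscillation_le_deviation[OF li ab] show ?thesis by (rule order_trans)
  qed
  then show "bmo_norm (\<lambda>x. f (h x)) \<le> ennreal (2 * (1 + 12 * C1))"
    using C by (subst bmo_norm_le_iff) auto
qed

text \<open>
  The composition operator is bounded on all of BMO, by homogeneity from the case of small norm.
\<close>
lemma compose_bmo: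
  assumes hk: "homeo_pair h k" and bd: "SQS_bound k C1 C2"
  obtains L where "0 < L"
    "\<And>f B. locally_integrable f \<Longrightarrow> 0 < B \<Longrightarrow> bmo_norm f \<le> ennreal B \<Longrightarrow>
       locally_integrable (\<lambda>x. f (h x)) \<and> bmo_norm (\<lambda>x. f (h x)) \<le> ennreal (L * B)"
proof -
  have C: "0 < C1" "0 < C2" using bd by (auto simp: SQS_bound_def)
  \<comment> \<open>The gain \<open>p\<close> in the decay rate has to make up for the loss \<open>C2\<close>.\<close>
  obtain p0 where "1 / C2 < real p0" using reals_Archimedean2 by blast
  then obtain p where p: "0 < p" "1 \<le> real p * C2"
    using C by (intro that[of p0]) (auto simp: field_simps intro: Nat.gr0I)
  define M where "M = 2 * (1 + 12 * C1)"
  have M: "0 < M" using C by (simp add: M_def)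
  show thesis
  proof (rule that[of "8 * real p * M"])
    show "0 < 8 * real p * M" using p M by simp
    fix f B assume f: "locally_integrable f" "0 < B" "bmo_norm f \<le> ennreal B"
    define s where "s = 8 * real p * B"
    have s: "0 < s" using p f by (simp add: s_def)
    define g where "g x = 1 / s * f x" for x
    have gli: "locally_integrable g" unfolding g_def using f(1) by (rule locally_integrable_cmult)
    have "bmo_norm g \<le> ennreal (\<bar>1 / s\<bar> * B)"
      unfolding g_def using f by (intro bmo_norm_cmult_le) auto
    also have "\<bar>1 / s\<bar> * B = 1 / (8 * real p)" using p f(2) by (simp add: s_def)
    finally have gb: "bmo_norm g \<le> ennreal (1 / (8 * real p))" .
    note gh = compose_small_bmo[OF hk bd p gli gb, folded M_def]
    have eq: "(\<lambda>x. f (h x)) = (\<lambda>x. s * g (h x))" using s by (simp add: g_def)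
    have "locally_integrable (\<lambda>x. f (h x))" unfolding eq by (rule locally_integrable_cmult[OF gh(1)])
    moreover have "bmo_norm (\<lambda>x. f (h x)) \<le> ennreal (\<bar>s\<bar> * M)"
      unfolding eq using gh(2) M by (intro bmo_norm_cmult_le) auto
    moreover have "\<bar>s\<bar> * M = 8 * real p * M * B" using s by (simp add: s_def)
    ultimately show "locally_integrable (\<lambda>x. f (h x)) \<and> bmo_norm (\<lambda>x. f (h x)) \<le> ennreal (8 * real p * M * B)"
      by simp
  qed
qed

section \<open>The inverse homeomorphism\<close>

text \<open>
  The change of variables formula holds off the null set where \<open>h\<close> is not differentiable, and by
  the SQS condition \<open>h\<close> maps that null set to a null set.
\<close>
lemma emeasure_image_eq_integral:
  fixes h :: "real \<Rightarrow> real"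
  assumes hk: "homeo_pair h k" and bd: "SQS_bound h C1 C2"
    and good: "AE x in lebesgue. h field_differentiable (at x) \<and> 0 < deriv h x"
    and A: "A \<in> sets lebesgue" "A \<subseteq> {a..b}"
  shows "emeasure lebesgue (h ` A) = (\<integral>\<^sup>+x\<in>A. ennreal (exp (ln (deriv h x))) \<partial>lebesgue)"
proof -
  obtain N where N: "N \<in> null_sets lebesgue" "{x. \<not> (h field_differentiable (at x) \<and> 0 < deriv h x)} \<subseteq> N"
    using good by (auto simp: eventually_ae_filter)
  define S where "S = A - N"
  have Nm: "N \<in> sets lebesgue" using N(1) by auto
  have Sm: "S \<in> sets lebesgue" unfolding S_def using A(1) Nm by (rule sets.Diff)
  have pos: "0 < deriv h x" "(h has_field_derivative deriv h x) (at x)" if "x \<in> S" for x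
    using that N(2) by (auto simp: S_def DERIV_deriv_iff_field_differentiable)
  have inj: "inj_on h S" by (rule inj_on_inverseI[of _ k]) (simp add: homeo_pair_inv[OF hk])
  have "h ` S \<subseteq> h ` {a..b}" using A(2) by (auto simp: S_def)
  then have hS: "h ` S \<in> lmeasurable"
    using lmeasurable_subset_Icc[OF SQS_bound_sets[OF bd Sm]] by (simp add: homeo_pair_image_Icc[OF hk])
  have "(\<lambda>x. 1 :: real) absolutely_integrable_on h ` S"
    using hS by (simp add: absolutely_integrable_on_const)
  moreover have "integral (h ` S) (\<lambda>x. 1) = measure lebesgue (h ` S)"
    using lmeasure_integral[OF hS] by simp
  ultimately have int: "(\<lambda>x. \<bar>deriv h x\<bar> * 1) absolutely_integrable_on S"
    "integral S (\<lambda>x. \<bar>deriv h x\<bar> * 1) = measure lebesgue (h ` S)"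
    using has_absolute_integral_change_of_variables_1'[OF Sm _ inj, of "deriv h" "\<lambda>_. 1" "measure lebesgue (h ` S)"]
      has_field_derivative_at_within[OF pos(2)] by blast+
  have "(\<integral>\<^sup>+x. ennreal (indicator S x *\<^sub>R (\<bar>deriv h x\<bar> * 1)) \<partial>lebesgue) = ennreal (measure lebesgue (h ` S))"
    using int(1) int(2)[folded set_lebesgue_integral_eq_integral(2)[OF int(1)]]
    unfolding set_integrable_def set_lebesgue_integral_def by (subst nn_integral_eq_integral) auto
  also have "\<dots> = emeasure lebesgue (h ` S)" using hS by (simp add: emeasure_eq_measure2)
  also have "\<dots> = emeasure lebesgue (h ` A)"
  proof (rule emeasure_eq_AE)
    have "AE y in lebesgue. y \<notin> h ` N" using SQS_bound_null_sets[OF hk bd N(1)] by (rule AE_not_in)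
    then show "AE y in lebesgue. y \<in> h ` S \<longleftrightarrow> y \<in> h ` A"
      by eventually_elim (auto simp: S_def)
  qed (use SQS_bound_sets[OF bd] Sm A(1) in auto)
  also have "(\<integral>\<^sup>+x. ennreal (indicator S x *\<^sub>R (\<bar>deriv h x\<bar> * 1)) \<partial>lebesgue)
      = (\<integral>\<^sup>+x\<in>A. ennreal (exp (ln (deriv h x))) \<partial>lebesgue)"
  proof (rule nn_integral_cong_AE)
    have "AE y in lebesgue. y \<notin> N" using N(1) by (rule AE_not_in)
    then show "AE x in lebesgue. ennreal (indicator S x *\<^sub>R (\<bar>deriv h x\<bar> * 1)) = ennreal (exp (ln (deriv h x))) * indicator A x"
      by eventually_elim (use pos(1) in \<open>auto simp: S_def indicator_def abs_of_pos\<close>)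
  qed
  finally show ?thesis by simp
qed

text \<open>
  Supplies the Cauchy--Schwarz inequality from the weighted inequality between the arithmetic and
  the geometric mean.
\<close>
lemma sqrt_optimisation:
  fixes m U V :: real
  assumes "0 \<le> U" "0 < V" "\<And>s. 0 < s \<Longrightarrow> 2 * m \<le> s * U + V / s"
  shows "m \<le> sqrt (U * V)"
proof (cases "U = 0")
  case True
  have "m \<le> 0"
  proof (rule ccontr)
    assume "\<not> m \<le> 0"
    then show False using assms(3)[of "V / m"] assms(2) True by simp
  qed
  then show ?thesis using True by simp
next
  case False
  then have U: "0 < U" using assms by simp
  have "2 * m \<le> sqrt (V / U) * U + V / sqrt (V / U)" using U assms by (intro assms(3)) auto
  also have "sqrt (V / U) * U = sqrt (U * V)"
    using U by (simp add: real_sqrt_divide real_sqrt_mult field_simps)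
  also have "V / sqrt (V / U) = sqrt (U * V)"
    using U assms(2) by (simp add: real_sqrt_divide real_sqrt_mult field_simps)
  finally show ?thesis by simp
qed

text \<open>
  The \<open>A\<^sub>2\<close> estimate. The hypothesis \<open>split\<close> says that \<open>ln h'\<close> differs from \<open>\<psi>\<close> by a bounded
  function. Integrating \<open>2 \<le> s w + 1 / (s w)\<close> for \<open>w = h'\<close> over \<open>A\<close> bounds \<open>2 \<bar>A\<bar>\<close> by \<open>s \<bar>h(A)\<bar>\<close>
  plus a multiple of the integral of \<open>1 / w\<close> over the whole interval. The exponential moment of
  \<open>\<psi>\<close> controls that integral and also \<open>\<bar>h(I)\<bar>\<close>, and the factors \<open>exp m\<close> and \<open>exp (- m)\<close> cancel in
  the product.
\<close>
lemma reverse_measure_bound: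
  fixes h :: "real \<Rightarrow> real"
  assumes hk: "homeo_pair h k" and bd: "SQS_bound h C1 C2"
    and good: "AE x in lebesgue. h field_differentiable (at x) \<and> 0 < deriv h x"
    and fm: "(\<lambda>x. ln (deriv h x)) \<in> borel_measurable lebesgue"
    and split: "\<And>x. \<bar>ln (deriv h x) - \<psi> x\<bar> \<le> M"
    and psi: "locally_integrable \<psi>" "bmo_norm \<psi> \<le> ennreal (1 / 8)"
    and ab: "a < b" and A: "A \<in> sets lebesgue" "A \<subseteq> {a..b}"
  shows "measure lebesgue A \<le> 13 * exp M * (measure lebesgue (h ` A) / (h b - h a)) powr (1 / 2) * (b - a)"
proof -
  define m where "m = interval_mean \<psi> a b"
  define E where "E x = exp \<bar>\<psi> x - m\<bar>" for x
  define H where "H = h b - h a"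
  define U where "U = measure lebesgue (h ` A)"
  define V where "V = exp (M - m) * (13 * (b - a))"
  have H: "0 < H" using homeo_pair_less[OF hk, of a b] ab by (simp add: H_def)
  have V: "0 < V" using ab by (simp add: V_def)
  have "\<psi> \<in> borel_measurable lebesgue" using psi(1) by (rule locally_integrable_measurable)
  then have "(\<lambda>x. exp \<bar>\<psi> x - m\<bar>) \<in> borel_measurable lebesgue" by measurable
  then have Em: "(\<lambda>x. ennreal (E x)) \<in> borel_measurable lebesgue" by (simp add: E_def[abs_def])
  have Im: "(indicator {a..b} :: real \<Rightarrow> ennreal) \<in> borel_measurable lebesgue"
    by (intro borel_measurable_indicator) auto
  have EI: "(\<integral>\<^sup>+x\<in>{a..b}. ennreal (E x) \<partial>lebesgue) \<le> ennreal (13 * (b - a))"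
    unfolding E_def m_def by (rule exp_integrability[OF psi ab])
  have scaled: "(\<integral>\<^sup>+x. ennreal c * (ennreal (E x) * indicator {a..b} x) \<partial>lebesgue) \<le> ennreal (c * (13 * (b - a)))"
    if "0 \<le> c" for c
  proof -
    have "(\<integral>\<^sup>+x. ennreal c * (ennreal (E x) * indicator {a..b} x) \<partial>lebesgue)
        = ennreal c * (\<integral>\<^sup>+x\<in>{a..b}. ennreal (E x) \<partial>lebesgue)"
      using Em Im by (intro nn_integral_cmult borel_measurable_times_ennreal)
    also have "\<dots> \<le> ennreal c * ennreal (13 * (b - a))" using EI by (rule mult_left_mono) simp
    finally show ?thesis using that ab by (simp add: ennreal_mult)
  qed
  have up: "exp (ln (deriv h x)) \<le> exp (M + m) * E x" for x
    using split[of x] by (simp add: E_def flip: exp_add)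
  have lo: "exp (- ln (deriv h x)) \<le> exp (M - m) * E x" for x
    using split[of x] by (simp add: E_def flip: exp_add)
  have hA: "emeasure lebesgue (h ` A) = ennreal U"
  proof -
    have "h ` A \<subseteq> {h a..h b}" using image_mono[OF A(2), of h] by (simp add: homeo_pair_image_Icc[OF hk])
    then show ?thesis unfolding U_def
      by (intro emeasure_eq_measure2 lmeasurable_subset_Icc[OF SQS_bound_sets[OF bd A(1)]])
  qed
  have "ennreal H = emeasure lebesgue (h ` {a..b})"
    using H by (simp add: homeo_pair_image_Icc[OF hk] H_def)
  also have "\<dots> = (\<integral>\<^sup>+x\<in>{a..b}. ennreal (exp (ln (deriv h x))) \<partial>lebesgue)"
    by (rule emeasure_image_eq_integral[OF hk bd good]) auto
  also have "\<dots> \<le> (\<integral>\<^sup>+x. ennreal (exp (M + m)) * (ennreal (E x) * indicator {a..b} x) \<partial>lebesgue)"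
    using up by (intro nn_integral_mono) (auto simp: indicator_def ennreal_mult[symmetric] E_def intro!: ennreal_leI)
  also have "\<dots> \<le> ennreal (exp (M + m) * (13 * (b - a)))" by (rule scaled) simp
  finally have HU: "H \<le> exp (M + m) * (13 * (b - a))" using ab by (subst (asm) ennreal_le_iff) auto
  have AM: "2 * measure lebesgue A \<le> s * U + V / s" if s: "0 < s" for s
  proof -
    have pt: "2 * indicator A x \<le> ennreal s * (ennreal (exp (ln (deriv h x))) * indicator A x)
        + ennreal (exp (M - m) / s) * (ennreal (E x) * indicator {a..b} x)" for x
    proof (cases "x \<in> A")
      case True
      define w where "w = exp (ln (deriv h x))"
      have w: "0 < w" by (simp add: w_def)
      have "0 \<le> (s * w - 1)\<^sup>2 / (s * w)" using s w by simp
      also have "\<dots> = s * w + 1 / (s * w) - 2" using s w by (simp add: power2_eq_square field_simps)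
      finally have "2 \<le> s * w + (1 / w) / s" by (simp add: mult.commute)
      also have "1 / w = exp (- ln (deriv h x))" by (simp add: w_def exp_minus inverse_eq_divide)
      also have "s * w + exp (- ln (deriv h x)) / s \<le> s * w + exp (M - m) / s * E x"
        using divide_right_mono[OF lo[of x], of s] s by simp
      finally have "ennreal 2 \<le> ennreal (s * w + exp (M - m) / s * E x)" by (rule ennreal_leI)
      also have "\<dots> = ennreal s * ennreal w + ennreal (exp (M - m) / s) * ennreal (E x)"
      proof -
        have "0 \<le> exp (M - m) / s" "0 \<le> E x" "0 \<le> s" "0 \<le> w" using s w by (auto simp: E_def)
        then show ?thesis by (simp only: ennreal_plus ennreal_mult mult_nonneg_nonneg)
      qed
      finally show ?thesis using True A(2) by (auto simp: w_def)
    qed simp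
    have wm: "(\<lambda>x. ennreal (exp (ln (deriv h x))) * indicator A x) \<in> borel_measurable lebesgue"
    proof -
      have "(\<lambda>x. ennreal (exp (F x))) \<in> borel_measurable lebesgue"
        if "F \<in> borel_measurable lebesgue" for F :: "real \<Rightarrow> real"
        using that by measurable
      from this[OF fm] show ?thesis
        using A(1) by (intro borel_measurable_times_ennreal borel_measurable_indicator)
    qed
    have "ennreal (2 * measure lebesgue A) = 2 * emeasure lebesgue A"
      using lmeasurable_subset_Icc[OF A] by (simp add: emeasure_eq_measure2 ennreal_mult)
    also have "\<dots> = (\<integral>\<^sup>+x. 2 * indicator A x \<partial>lebesgue)" using A(1) by (simp add: nn_integral_cmult)
    also have "\<dots> \<le> (\<integral>\<^sup>+x. ennreal s * (ennreal (exp (ln (deriv h x))) * indicator A x)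
        + ennreal (exp (M - m) / s) * (ennreal (E x) * indicator {a..b} x) \<partial>lebesgue)"
      by (intro nn_integral_mono pt)
    also have "\<dots> = (\<integral>\<^sup>+x. ennreal s * (ennreal (exp (ln (deriv h x))) * indicator A x) \<partial>lebesgue)
        + (\<integral>\<^sup>+x. ennreal (exp (M - m) / s) * (ennreal (E x) * indicator {a..b} x) \<partial>lebesgue)"
      by (intro nn_integral_add borel_measurable_times_ennreal[OF borel_measurable_const wm]
          borel_measurable_times_ennreal[OF borel_measurable_const borel_measurable_times_ennreal[OF Em Im]])
    also have "(\<integral>\<^sup>+x. ennreal s * (ennreal (exp (ln (deriv h x))) * indicator A x) \<partial>lebesgue) = ennreal (s * U)"
      using s wm emeasure_image_eq_integral[OF hk bd good A] hA by (simp add: nn_integral_cmult ennreal_mult U_def)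
    also have "(\<integral>\<^sup>+x. ennreal (exp (M - m) / s) * (ennreal (E x) * indicator {a..b} x) \<partial>lebesgue)
        \<le> ennreal (exp (M - m) / s * (13 * (b - a)))" using s by (intro scaled) simp
    also have "exp (M - m) / s * (13 * (b - a)) = V / s" by (simp add: V_def)
    finally have "ennreal (2 * measure lebesgue A) \<le> ennreal (s * U) + ennreal (V / s)" by simp
    also have "\<dots> = ennreal (s * U + V / s)"
      using s V by (intro ennreal_plus[symmetric]) (auto simp: U_def)
    finally show ?thesis using s V by (subst (asm) ennreal_le_iff) (auto simp: U_def)
  qed
  have "measure lebesgue A \<le> sqrt (U * V)"
    by (rule sqrt_optimisation) (use V AM in \<open>auto simp: U_def\<close>)
  also have "U * V = U / H * (H * V)" using H by simp
  also have "\<dots> \<le> U / H * (exp (M + m) * (13 * (b - a)) * V)"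
    using HU H V by (intro mult_left_mono mult_right_mono) (auto simp: U_def)
  also have "\<dots> = U / H * (13 * exp M * (b - a))\<^sup>2"
  proof -
    have "exp (M + m) * exp (M - m) = exp M * exp M" by (simp flip: exp_add)
    then have "exp (M + m) * (13 * (b - a)) * V = (exp M * exp M) * (13 * (b - a)) * (13 * (b - a))"
      unfolding V_def by (metis mult.assoc mult.left_commute)
    then show ?thesis by (simp add: power2_eq_square mult_ac)
  qed
  finally have "measure lebesgue A \<le> sqrt (U / H * (13 * exp M * (b - a))\<^sup>2)" by simp
  also have "\<dots> = sqrt (U / H) * (13 * exp M * (b - a))"
  proof -
    have "0 \<le> 13 * exp M * (b - a)" using ab by simp
    then show ?thesis by (simp only: real_sqrt_mult real_sqrt_abs abs_of_nonneg)
  qed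
  also have "sqrt (U / H) = (U / H) powr (1 / 2)" using H by (simp add: powr_half_sqrt U_def)
  also have "(U / H) powr (1 / 2) * (13 * exp M * (b - a)) = 13 * exp M * (U / H) powr (1 / 2) * (b - a)"
    by (simp only: mult_ac)
  finally show ?thesis by (simp only: U_def H_def)
qed

section \<open>The space CMO\<close>

lemma continuous_locally_integrable:
  assumes "continuous_on UNIV f" shows "locally_integrable f"
  unfolding locally_integrable_def
  using continuous_on_subset[OF assms] by (auto intro: absolutely_integrable_continuous_real)

lemma Cc_locally_integrable: "\<phi> \<in> Cc \<Longrightarrow> locally_integrable \<phi>"
  by (simp add: Cc_def continuous_locally_integrable)

lemma Cc_intro:
  assumes "continuous_on UNIV \<phi>" "compact K" "{x. \<phi> x \<noteq> 0} \<subseteq> K"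
  shows "\<phi> \<in> Cc"
proof -
  have "closure {x. \<phi> x \<noteq> 0} \<subseteq> K" using assms(2,3) by (simp add: closure_minimal compact_imp_closed)
  then have "compact (closure {x. \<phi> x \<noteq> 0})"
    using assms(2) by (metis closed_closure compact_Int_closed inf.absorb_iff2)
  then show ?thesis using assms(1) by (simp add: Cc_def)
qed

lemma Cc_add:
  assumes "\<phi> \<in> Cc" "\<psi> \<in> Cc" shows "(\<lambda>x. \<phi> x + \<psi> x) \<in> Cc"
proof (rule Cc_intro)
  show "{x. \<phi> x + \<psi> x \<noteq> 0} \<subseteq> closure {x. \<phi> x \<noteq> 0} \<union> closure {x. \<psi> x \<noteq> 0}"
  proof -
    have "{x. \<phi> x + \<psi> x \<noteq> 0} \<subseteq> {x. \<phi> x \<noteq> 0} \<union> {x. \<psi> x \<noteq> 0}" by auto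
    then show ?thesis by (rule order_trans) (intro Un_mono closure_subset)
  qed
qed (use assms in \<open>auto simp: Cc_def intro: continuous_on_add\<close>)

lemma Cc_uminus: "\<phi> \<in> Cc \<Longrightarrow> (\<lambda>x. - \<phi> x) \<in> Cc"
  by (simp add: Cc_def continuous_on_minus)

lemma Cc_compose:
  assumes hk: "homeo_pair h k" and phi: "\<phi> \<in> Cc" shows "(\<lambda>x. \<phi> (h x)) \<in> Cc"
proof (rule Cc_intro)
  have cont: "continuous_on UNIV h" "continuous_on UNIV k" using hk by (auto simp: homeo_pair_def)
  show "continuous_on UNIV (\<lambda>x. \<phi> (h x))"
    by (rule continuous_on_compose2[OF _ cont(1)]) (use phi in \<open>auto simp: Cc_def\<close>)
  show "compact (k ` closure {x. \<phi> x \<noteq> 0})"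
    by (rule compact_continuous_image) (use phi cont in \<open>auto simp: Cc_def intro: continuous_on_subset\<close>)
  show "{x. \<phi> (h x) \<noteq> 0} \<subseteq> k ` closure {x. \<phi> x \<noteq> 0}"
  proof
    fix x assume "x \<in> {x. \<phi> (h x) \<noteq> 0}"
    then have "h x \<in> {x. \<phi> x \<noteq> 0}" by simp
    then have "h x \<in> closure {x. \<phi> x \<noteq> 0}" by (rule subsetD[OF closure_subset])
    then show "x \<in> k ` closure {x. \<phi> x \<noteq> 0}"
      by (intro image_eqI[of _ _ "h x"]) (auto simp: homeo_pair_inv[OF hk])
  qed
qed

lemma Cc_bounded:
  assumes "\<phi> \<in> Cc" obtains M where "\<And>x. \<bar>\<phi> x\<bar> \<le> M"
proof -
  have "compact (\<phi> ` closure {x. \<phi> x \<noteq> 0})"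
    by (rule compact_continuous_image) (use assms in \<open>auto simp: Cc_def intro: continuous_on_subset\<close>)
  then obtain M where M: "\<And>y. y \<in> \<phi> ` closure {x. \<phi> x \<noteq> 0} \<Longrightarrow> \<bar>y\<bar> \<le> M"
    by (metis compact_imp_bounded bounded_real)
  have "\<bar>\<phi> x\<bar> \<le> max M 0" for x
  proof (cases "\<phi> x = 0")
    case False
    then have "x \<in> {x. \<phi> x \<noteq> 0}" by simp
    then have "x \<in> closure {x. \<phi> x \<noteq> 0}" by (rule subsetD[OF closure_subset])
    then show ?thesis using M[of "\<phi> x"] by auto
  qed auto
  then show thesis by (rule that)
qed

lemma mean_oscillation_add:
  assumes f: "locally_integrable f" and g: "locally_integrable g" and ab: "a < b"
  shows "mean_oscillation (\<lambda>x. f x + g x) a b \<le> mean_oscillation f a b + mean_oscillation g a b"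
proof -
  define p where "p = interval_mean f a b"
  define q where "q = interval_mean g a b"
  have m: "interval_mean (\<lambda>x. f x + g x) a b = p + q"
    using f g by (simp add: interval_mean_def p_def q_def locally_integrableD add_divide_distrib)
  have li: "set_integrable lebesgue {a..b} (\<lambda>x. \<bar>u x - c\<bar>)" if "locally_integrable u" for u c
    by (intro locally_integrableD locally_integrable_abs locally_integrable_diff that locally_integrable_const)
  have "(LINT x:{a..b}|lebesgue. \<bar>f x + g x - (p + q)\<bar>) \<le> (LINT x:{a..b}|lebesgue. \<bar>f x - p\<bar> + \<bar>g x - q\<bar>)"
    by (intro set_integral_mono set_integral_add li locally_integrable_add f g) auto
  also have "\<dots> = (LINT x:{a..b}|lebesgue. \<bar>f x - p\<bar>) + (LINT x:{a..b}|lebesgue. \<bar>g x - q\<bar>)"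
    by (intro set_integral_add li f g)
  finally have "(LINT x:{a..b}|lebesgue. \<bar>f x + g x - (p + q)\<bar>) / (b - a)
      \<le> ((LINT x:{a..b}|lebesgue. \<bar>f x - p\<bar>) + (LINT x:{a..b}|lebesgue. \<bar>g x - q\<bar>)) / (b - a)"
    using ab by (intro divide_right_mono) auto
  then show ?thesis unfolding mean_oscillation_def m by (simp only: p_def q_def add_divide_distrib)
qed

lemma bmo_norm_add:
  assumes f: "locally_integrable f" "bmo_norm f \<le> ennreal A" "0 \<le> A"
    and g: "locally_integrable g" "bmo_norm g \<le> ennreal B" "0 \<le> B"
  shows "bmo_norm (\<lambda>x. f x + g x) \<le> ennreal (A + B)"
proof -
  have "mean_oscillation (\<lambda>x. f x + g x) a b \<le> A + B" if "a < b" for a b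
  proof -
    have "mean_oscillation f a b \<le> A" "mean_oscillation g a b \<le> B"
      using f g that by (auto simp: bmo_norm_le_iff)
    then show ?thesis using mean_oscillation_add[OF f(1) g(1) that] by linarith
  qed
  then show ?thesis using f g by (subst bmo_norm_le_iff) auto
qed

lemma BMO_iff: "f \<in> BMO \<longleftrightarrow> locally_integrable f \<and> (\<exists>B>0. bmo_norm f \<le> ennreal B)"
proof -
  have "\<exists>B>0. bmo_norm f \<le> ennreal B" if "bmo_norm f < \<infinity>"
  proof -
    have "bmo_norm f = ennreal (enn2real (bmo_norm f))" using that by simp
    also have "\<dots> \<le> ennreal (enn2real (bmo_norm f) + 1)" by (intro ennreal_leI) simp
    finally show ?thesis by (intro exI[of _ "enn2real (bmo_norm f) + 1"]) (auto simp: add_nonneg_pos)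
  qed
  moreover have "bmo_norm f < \<infinity>" if "bmo_norm f \<le> ennreal B" for B
    using that by (rule order_le_less_trans) simp
  ultimately show ?thesis by (auto simp: BMO_def)
qed

lemma CMO_iff:
  "f \<in> CMO \<longleftrightarrow> f \<in> BMO \<and> (\<forall>\<epsilon>>0. \<exists>\<phi>\<in>Cc. bmo_norm (\<lambda>x. f x - \<phi> x) \<le> ennreal \<epsilon>)"
proof -
  have "(\<forall>\<epsilon>>0. \<exists>\<phi>\<in>Cc. bmo_norm (\<lambda>x. f x - \<phi> x) < ennreal \<epsilon>)"
    if *: "\<forall>\<epsilon>>0. \<exists>\<phi>\<in>Cc. bmo_norm (\<lambda>x. f x - \<phi> x) \<le> ennreal \<epsilon>"
  proof (intro allI impI)
    fix \<epsilon> :: real assume e: "0 < \<epsilon>"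
    then obtain \<phi> where "\<phi> \<in> Cc" "bmo_norm (\<lambda>x. f x - \<phi> x) \<le> ennreal (\<epsilon> / 2)" using * half_gt_zero by blast
    moreover have "ennreal (\<epsilon> / 2) < ennreal \<epsilon>" using e by (intro ennreal_lessI) auto
    ultimately show "\<exists>\<phi>\<in>Cc. bmo_norm (\<lambda>x. f x - \<phi> x) < ennreal \<epsilon>" by (meson order_le_less_trans)
  qed
  then show ?thesis unfolding CMO_def using less_imp_le by blast
qed

lemma CMO_locally_integrable: "f \<in> CMO \<Longrightarrow> locally_integrable f"
  by (simp add: CMO_def BMO_def)

lemma CMO_zero: "(\<lambda>x. 0) \<in> CMO"
proof -
  have z: "bmo_norm (\<lambda>x. 0) \<le> ennreal B" if "0 < B" for B
    using that by (subst bmo_norm_le_iff) (auto simp: mean_oscillation_def interval_mean_def)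
  moreover have "(\<lambda>x. 0) \<in> Cc" by (rule Cc_intro[of _ "{}"]) auto
  ultimately show ?thesis
    unfolding CMO_iff BMO_iff using z[of 1] locally_integrable_const
    by (intro conjI allI impI exI[of _ 1] bexI[of _ "\<lambda>x. 0"]) simp_all
qed

lemma CMO_add:
  assumes "f \<in> CMO" "g \<in> CMO" shows "(\<lambda>x. f x + g x) \<in> CMO"
  unfolding CMO_iff
proof (intro conjI allI impI)
  have li: "locally_integrable f" "locally_integrable g" using assms by (auto intro: CMO_locally_integrable)
  obtain A B where "0 < A" "bmo_norm f \<le> ennreal A" "0 < B" "bmo_norm g \<le> ennreal B"
    using assms by (auto simp: CMO_iff BMO_iff)
  then show "(\<lambda>x. f x + g x) \<in> BMO"
    unfolding BMO_iff using li by (intro conjI exI[of _ "A + B"] bmo_norm_add locally_integrable_add) auto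
  fix \<epsilon> :: real assume "0 < \<epsilon>"
  then have e: "0 < \<epsilon> / 2" by simp
  obtain \<phi> \<psi> where p: "\<phi> \<in> Cc" "bmo_norm (\<lambda>x. f x - \<phi> x) \<le> ennreal (\<epsilon> / 2)"
    "\<psi> \<in> Cc" "bmo_norm (\<lambda>x. g x - \<psi> x) \<le> ennreal (\<epsilon> / 2)"
    using assms e unfolding CMO_iff by meson
  have "bmo_norm (\<lambda>x. (f x - \<phi> x) + (g x - \<psi> x)) \<le> ennreal (\<epsilon> / 2 + \<epsilon> / 2)"
    using e p li by (intro bmo_norm_add locally_integrable_diff) (auto intro: Cc_locally_integrable)
  then have "bmo_norm (\<lambda>x. (f x + g x) - (\<phi> x + \<psi> x)) \<le> ennreal \<epsilon>" by (simp add: add_diff_add)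
  then show "\<exists>\<phi>\<in>Cc. bmo_norm (\<lambda>x. (f x + g x) - \<phi> x) \<le> ennreal \<epsilon>"
    using Cc_add[OF p(1,3)] by (intro bexI[of _ "\<lambda>x. \<phi> x + \<psi> x"])
qed

lemma bmo_norm_uminus: "bmo_norm (\<lambda>x. - f x) = bmo_norm f"
  using mean_oscillation_cmult[of "-1" f] by (simp add: bmo_norm_def)

lemma CMO_uminus:
  assumes "f \<in> CMO" shows "(\<lambda>x. - f x) \<in> CMO"
  unfolding CMO_iff
proof (intro conjI allI impI)
  show "(\<lambda>x. - f x) \<in> BMO"
    using assms locally_integrable_cmult[of f "-1"] by (auto simp: CMO_def BMO_def bmo_norm_uminus)
  fix \<epsilon> :: real assume "0 < \<epsilon>"
  then obtain \<phi> where p: "\<phi> \<in> Cc" "bmo_norm (\<lambda>x. f x - \<phi> x) \<le> ennreal \<epsilon>" using assms unfolding CMO_iff by meson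
  then have "bmo_norm (\<lambda>x. - f x - - \<phi> x) \<le> ennreal \<epsilon>"
    using bmo_norm_uminus[of "\<lambda>x. f x - \<phi> x"] by (simp add: minus_diff_commute)
  then show "\<exists>\<phi>\<in>Cc. bmo_norm (\<lambda>x. - f x - \<phi> x) \<le> ennreal \<epsilon>"
    using Cc_uminus[OF p(1)] by (intro bexI[of _ "\<lambda>x. - \<phi> x"])
qed

text \<open>
  The BMO bound for \<open>f \<mapsto> f \<circ> h\<close> carries an approximation of \<open>f\<close> over to one of \<open>f \<circ> h\<close>.
\<close>
lemma CMO_compose:
  assumes hk: "homeo_pair h k" and bd: "SQS_bound k C1 C2" and f: "f \<in> CMO"
  shows "(\<lambda>x. f (h x)) \<in> CMO"
proof -
  obtain L where L: "0 < L" "\<And>f B. locally_integrable f \<Longrightarrow> 0 < B \<Longrightarrow> bmo_norm f \<le> ennreal B \<Longrightarrow>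
       locally_integrable (\<lambda>x. f (h x)) \<and> bmo_norm (\<lambda>x. f (h x)) \<le> ennreal (L * B)"
    using compose_bmo[OF hk bd] by metis
  have li: "locally_integrable f" using f by (rule CMO_locally_integrable)
  show ?thesis unfolding CMO_iff
  proof (intro conjI allI impI)
    obtain B where "0 < B" "bmo_norm f \<le> ennreal B" using f by (auto simp: CMO_iff BMO_iff)
    then show "(\<lambda>x. f (h x)) \<in> BMO"
      unfolding BMO_iff using L li by (metis mult_pos_pos)
    fix \<epsilon> :: real assume "0 < \<epsilon>"
    then have e: "0 < \<epsilon> / L" using L(1) by simp
    then obtain \<phi> where p: "\<phi> \<in> Cc" "bmo_norm (\<lambda>x. f x - \<phi> x) \<le> ennreal (\<epsilon> / L)" using f unfolding CMO_iff by meson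
    have "bmo_norm (\<lambda>x. f (h x) - \<phi> (h x)) \<le> ennreal (L * (\<epsilon> / L))"
      using L(2)[OF locally_integrable_diff[OF li Cc_locally_integrable[OF p(1)]] e p(2)] by simp
    then have "bmo_norm (\<lambda>x. f (h x) - \<phi> (h x)) \<le> ennreal \<epsilon>" using L(1) by simp
    then show "\<exists>\<phi>\<in>Cc. bmo_norm (\<lambda>x. f (h x) - \<phi> x) \<le> ennreal \<epsilon>"
      using Cc_compose[OF hk p(1)] by (intro bexI[of _ "\<lambda>x. \<phi> (h x)"])
  qed
qed

lemma set_integral_cong_AE_lebesgue:
  fixes f g :: "real \<Rightarrow> real"
  assumes "AE x in lebesgue. f x = g x" "f \<in> borel_measurable lebesgue" "g \<in> borel_measurable lebesgue"
  shows "(LINT x:{a..b}|lebesgue. f x) = (LINT x:{a..b}|lebesgue. g x)"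
  using assms by (intro set_lebesgue_integral_cong_AE) auto

text \<open>
  Needed because the chain rule identifies the logarithmic derivatives only almost everywhere.
\<close>
lemma CMO_cong_AE:
  assumes ae: "AE x in lebesgue. f x = g x" and f: "f \<in> CMO"
  shows "g \<in> CMO"
proof -
  have fli: "locally_integrable f" using f by (rule CMO_locally_integrable)
  have fm: "f \<in> borel_measurable lebesgue" using fli by (rule locally_integrable_measurable)
  have gm: "g \<in> borel_measurable lebesgue"
    using fm ae by (rule borel_measurable_AE)
  have gli: "locally_integrable g"
    unfolding locally_integrable_def
  proof (intro allI)
    fix a b
    have "set_integrable lebesgue {a..b} f \<longleftrightarrow> set_integrable lebesgue {a..b} g"
      using fm gm ae by (intro set_integrable_cong_AE) auto
    then show "set_integrable lebesgue {a..b} g" using locally_integrableD[OF fli] by simp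
  qed
  have bmo: "bmo_norm (\<lambda>x. g x - \<phi> x) = bmo_norm (\<lambda>x. f x - \<phi> x)" if pm: "\<phi> \<in> borel_measurable lebesgue" for \<phi>
  proof -
    have "interval_mean (\<lambda>x. g x - \<phi> x) a b = interval_mean (\<lambda>x. f x - \<phi> x) a b" for a b
      unfolding interval_mean_def
      by (intro arg_cong2[where f="(/)"] set_integral_cong_AE_lebesgue refl borel_measurable_diff gm fm pm)
         (use ae in eventually_elim, simp)
    then have "mean_oscillation (\<lambda>x. g x - \<phi> x) a b = mean_oscillation (\<lambda>x. f x - \<phi> x) a b" for a b
      unfolding mean_oscillation_def
      by (intro arg_cong2[where f="(/)"] set_integral_cong_AE_lebesgue refl borel_measurable_abs borel_measurable_diff gm fm pm borel_measurable_const)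
         (use ae in eventually_elim, simp)
    then show ?thesis by (simp add: bmo_norm_def)
  qed
  have "bmo_norm g = bmo_norm f" using bmo[of "\<lambda>x. 0"] by simp
  moreover have "bmo_norm (\<lambda>x. g x - \<phi> x) = bmo_norm (\<lambda>x. f x - \<phi> x)" if "\<phi> \<in> Cc" for \<phi>
    using that by (intro bmo locally_integrable_measurable Cc_locally_integrable)
  ultimately show ?thesis using f gli by (auto simp: CMO_def BMO_def)
qed

section \<open>The group\<close>

lemma SS0_derivative:
  "h \<in> SS0 \<Longrightarrow> AE x in lebesgue. h field_differentiable (at x) \<and> 0 < deriv h x"
  by (simp only: SS0_def mem_Collect_eq)

lemma SS0_log_deriv: "h \<in> SS0 \<Longrightarrow> (\<lambda>x. ln (deriv h x)) \<in> CMO"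
  by (simp only: SS0_def mem_Collect_eq)

text \<open>
  The reverse bound already has the form of the SQS condition for \<open>k\<close>, except that it presupposes
  the measurability of \<open>A = k(B)\<close>. For Borel \<open>B\<close> this is continuity of \<open>h\<close>; for null sets it
  follows from the bound itself, applied to a Borel null set containing \<open>B\<close>.
\<close>
lemma inverse_SQS_bound:
  assumes hk: "homeo_pair h k" and bd: "SQS_bound h C1 C2" and h: "h \<in> SS0"
  shows "\<exists>K1 K2. SQS_bound k K1 K2"
proof -
  note good = SS0_derivative[OF h] and cmo = SS0_log_deriv[OF h]
  note li = CMO_locally_integrable[OF cmo]
  obtain \<phi> where p: "\<phi> \<in> Cc" "bmo_norm (\<lambda>x. ln (deriv h x) - \<phi> x) \<le> ennreal (1 / 8)"
    using cmo unfolding CMO_iff by (metis zero_less_divide_1_iff zero_less_numeral)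
  obtain M where M: "\<And>x. \<bar>\<phi> x\<bar> \<le> M" using Cc_bounded[OF p(1)] by blast
  have rev: "measure lebesgue A \<le> 13 * exp M * (measure lebesgue (h ` A) / (h b - h a)) powr (1 / 2) * (b - a)"
    if "a < b" "A \<in> sets lebesgue" "A \<subseteq> {a..b}" for a b A
    by (rule reverse_measure_bound[OF hk bd good locally_integrable_measurable[OF li] _
          locally_integrable_diff[OF li Cc_locally_integrable[OF p(1)]] p(2) that])
       (simp add: M)
  have kimage: "k ` B = h -` B" for B
    using homeo_pair_image[OF homeo_pair_sym[OF hk], of "\<lambda>x. x \<in> B"] by (simp add: vimage_def)
  have hk_image: "h ` (k ` B) = B" for B :: "real set" by (auto simp: image_image homeo_pair_inv[OF hk])
  have contm: "h \<in> borel_measurable borel"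
    using hk by (intro borel_measurable_continuous_onI) (simp add: homeo_pair_def)
  have borel_image: "k ` B \<in> sets borel" if "B \<in> sets borel" for B
    using measurable_sets[OF contm that] by (simp add: kimage)
  have k_Icc: "k ` B \<subseteq> {k c..k d}" if "B \<subseteq> {c..d}" for B c d
    using image_mono[OF that, of k] homeo_pair_image_Icc[OF homeo_pair_sym[OF hk]] by simp
  have sets_image: "k ` B \<in> sets lebesgue" if cd: "c < d" and B: "B \<in> sets lebesgue" "B \<subseteq> {c..d}" for B c d
  proof -
    from B(1) obtain S N N' where SN: "B = S \<union> N" "N \<subseteq> N'" "N' \<in> null_sets lborel" "S \<in> sets lborel"
      by (rule sets_completionE)
    define Z where "Z = N' \<inter> {c..d}"
    have Zb: "Z \<in> sets borel" and Zn: "Z \<in> null_sets lborel"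
      using SN(3) by (auto simp: Z_def intro: null_set_Int2)
    have kZ: "k ` Z \<in> sets lebesgue" using borel_image[OF Zb] by (simp add: sets_completionI_sets)
    have sub: "k ` Z \<subseteq> {k c..k d}" by (rule k_Icc) (simp add: Z_def)
    have "measure lebesgue Z = 0" using null_sets_completionI[OF Zn] by (auto simp: measure_def)
    then have "measure lebesgue (k ` Z) \<le> 0"
      using rev[OF _ kZ sub] cd by (simp add: hk_image homeo_pair_less[OF homeo_pair_sym[OF hk]])
    then have "measure lebesgue (k ` Z) = 0" by (simp add: order_antisym)
    then have "negligible (k ` Z)" using lmeasurable_subset_Icc[OF kZ sub] by (simp add: negligible_iff_measure)
    moreover have "k ` N \<subseteq> k ` Z" using SN(1,2) B(2) by (auto simp: Z_def)
    ultimately have "negligible (k ` N)" by (rule negligible_subset)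
    then have "k ` N \<in> sets lebesgue" by (simp add: negligible_imp_sets)
    moreover have "k ` S \<in> sets lebesgue" using borel_image SN(4) by (simp add: sets_completionI_sets)
    ultimately show ?thesis by (simp add: SN(1) image_Un sets.Un)
  qed
  have "SQS_bound k (13 * exp M) (1 / 2)"
    unfolding SQS_bound_def
  proof (intro conjI allI impI)
    fix c d :: real and B assume cd: "c < d" and B: "B \<in> sets lebesgue" "B \<subseteq> {c..d}"
    show s: "k ` B \<in> sets lebesgue" using cd B by (rule sets_image)
    have "k c < k d" using cd by (simp add: homeo_pair_less[OF homeo_pair_sym[OF hk]])
    from rev[OF this s k_Icc[OF B(2)]]
    show "measure lebesgue (k ` B) \<le> 13 * exp M * (measure lebesgue B / (d - c)) powr (1 / 2) * (k d - k c)"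
      by (simp only: hk_image homeo_pair_inv[OF hk])
  qed auto
  then show ?thesis by blast
qed

lemma SS0_obtain:
  assumes "h \<in> SS0"
  obtains k C1 C2 K1 K2 where "homeo_pair h k" "SQS_bound h C1 C2" "SQS_bound k K1 K2"
proof -
  have "h \<in> SQS" using assms by (simp add: SS0_def)
  then have "sense_preserving_homeo h" by (simp add: SQS_def)
  then obtain k where hk: "homeo_pair h k" using homeo_pair_exists by blast
  obtain C1 C2 where bd: "SQS_bound h C1 C2" using \<open>h \<in> SQS\<close> SQS_iff[OF hk] by blast
  obtain K1 K2 where "SQS_bound k K1 K2" using inverse_SQS_bound[OF hk bd assms] by blast
  then show thesis using hk bd that by blast
qed

lemma AE_preimage:
  assumes hk: "homeo_pair h k" and bd: "SQS_bound k C1 C2" and P: "AE y in lebesgue. P y"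
  shows "AE x in lebesgue. P (h x)"
proof -
  obtain N where N: "N \<in> null_sets lebesgue" "{y. \<not> P y} \<subseteq> N" using P by (auto simp: eventually_ae_filter)
  have "AE x in lebesgue. x \<notin> k ` N"
    using SQS_bound_null_sets[OF homeo_pair_sym[OF hk] bd N(1)] by (rule AE_not_in)
  then show ?thesis
  proof eventually_elim
    case (elim x)
    have "h x \<notin> N" using elim homeo_pair_inv(2)[OF hk, of x] by (metis imageI)
    then show ?case using N(2) by blast
  qed
qed

lemma SS0_id: "id \<in> SS0"
proof -
  have hp: "homeo_pair id id" by (auto simp: homeo_pair_def strict_mono_def)
  have "measure lebesgue A \<le> 1 * (measure lebesgue A / (b - a)) powr 1 * (b - a)" if "a < b" for a b :: real and A
    using that by (simp add: measure_nonneg)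
  then have "SQS_bound id 1 1" by (simp add: SQS_bound_def)
  then have "id \<in> SQS" using SQS_iff[OF hp] by blast
  moreover have "deriv id x = 1" "id field_differentiable at x" for x :: real
    by (auto simp: field_differentiable_def intro!: DERIV_imp_deriv DERIV_ident[unfolded id_def[symmetric]])
  ultimately show ?thesis using CMO_zero by (simp add: SS0_def)
qed

lemma homeo_pair_comp:
  assumes g: "homeo_pair g g'" and h: "homeo_pair h h'" shows "homeo_pair (g \<circ> h) (h' \<circ> g')"
proof -
  have "continuous_on UNIV (u \<circ> v)" if "continuous_on UNIV u" "continuous_on UNIV v" for u v :: "real \<Rightarrow> real"
    using that by (metis continuous_on_compose continuous_on_subset top_greatest)
  then show ?thesis using g h by (auto simp: homeo_pair_def strict_mono_def)
qed

lemma SQS_bound_comp: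
  assumes hk: "homeo_pair h k" and g: "homeo_pair g g'" "SQS_bound g C1 C2" and h: "SQS_bound h D1 D2"
  shows "SQS_bound (g \<circ> h) (C1 * D1 powr C2) (D2 * C2)"
  unfolding SQS_bound_def
proof (intro conjI allI impI)
  have pos: "0 < C1" "0 < C2" "0 < D1" "0 < D2" using g h by (auto simp: SQS_bound_def)
  show "0 < C1 * D1 powr C2" "0 < D2 * C2" using pos by auto
  fix a b :: real and A assume ab: "a < b" and A: "A \<in> sets lebesgue" "A \<subseteq> {a..b}"
  have hA: "h ` A \<in> sets lebesgue" "measure lebesgue (h ` A) \<le> D1 * (measure lebesgue A / (b - a)) powr D2 * (h b - h a)"
    using h ab A unfolding SQS_bound_def by blast+
  have hab: "h a < h b" using ab by (simp add: homeo_pair_less[OF hk])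
  have "h ` A \<subseteq> {h a..h b}" using image_mono[OF A(2), of h] by (simp add: homeo_pair_image_Icc[OF hk])
  then have gh: "g ` h ` A \<in> sets lebesgue"
    "measure lebesgue (g ` h ` A) \<le> C1 * (measure lebesgue (h ` A) / (h b - h a)) powr C2 * (g (h b) - g (h a))"
    using g(2) hab hA(1) unfolding SQS_bound_def by blast+
  show "(g \<circ> h) ` A \<in> sets lebesgue" using gh(1) by (simp add: image_comp)
  have "measure lebesgue (h ` A) / (h b - h a) \<le> D1 * (measure lebesgue A / (b - a)) powr D2"
    using hA(2) hab by (simp add: pos_divide_le_eq)
  then have "(measure lebesgue (h ` A) / (h b - h a)) powr C2 \<le> (D1 * (measure lebesgue A / (b - a)) powr D2) powr C2"
    using pos hab by (intro powr_mono2) auto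
  also have "\<dots> = D1 powr C2 * (measure lebesgue A / (b - a)) powr (D2 * C2)"
    using pos ab by (simp add: powr_mult powr_powr)
  finally have "C1 * (measure lebesgue (h ` A) / (h b - h a)) powr C2 * (g (h b) - g (h a))
      \<le> C1 * (D1 powr C2 * (measure lebesgue A / (b - a)) powr (D2 * C2)) * (g (h b) - g (h a))"
    using pos hab homeo_pair_less[OF g(1), of "h a" "h b"] by (intro mult_right_mono mult_left_mono) auto
  then show "measure lebesgue ((g \<circ> h) ` A) \<le> C1 * D1 powr C2 * (measure lebesgue A / (b - a)) powr (D2 * C2) * ((g \<circ> h) b - (g \<circ> h) a)"
    using gh(2) by (simp add: image_comp mult.assoc)
qed

lemma SS0_comp:
  assumes g: "g \<in> SS0" and h: "h \<in> SS0" shows "g \<circ> h \<in> SS0"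
proof -
  obtain g' C1 C2 where gp: "homeo_pair g g'" "SQS_bound g C1 C2" using SS0_obtain[OF g] by metis
  obtain k D1 D2 K1 K2 where hp: "homeo_pair h k" "SQS_bound h D1 D2" "SQS_bound k K1 K2"
    using SS0_obtain[OF h] by metis
  have "AE x in lebesgue. g field_differentiable (at (h x)) \<and> 0 < deriv g (h x)"
    using AE_preimage[OF hp(1,3) SS0_derivative[OF g]] .
  moreover have "AE x in lebesgue. h field_differentiable (at x) \<and> 0 < deriv h x" using h by (rule SS0_derivative)
  ultimately have ae: "AE x in lebesgue. (g \<circ> h) field_differentiable (at x) \<and> 0 < deriv (g \<circ> h) x
      \<and> ln (deriv g (h x)) + ln (deriv h x) = ln (deriv (g \<circ> h) x)"
  proof eventually_elim
    case (elim x)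
    then have "deriv (g \<circ> h) x = deriv g (h x) * deriv h x" by (intro deriv_chain) auto
    moreover have "(g \<circ> h) field_differentiable (at x)" using elim by (intro field_differentiable_compose) auto
    ultimately show ?case using elim by (simp add: ln_mult)
  qed
  have "(\<lambda>x. ln (deriv g (h x))) \<in> CMO"
    using CMO_compose[OF hp(1,3) SS0_log_deriv[OF g]] .
  then have "(\<lambda>x. ln (deriv g (h x)) + ln (deriv h x)) \<in> CMO" using SS0_log_deriv[OF h] by (rule CMO_add)
  then have "(\<lambda>x. ln (deriv (g \<circ> h) x)) \<in> CMO"
    by (rule CMO_cong_AE[rotated]) (use ae in eventually_elim, simp)
  moreover have "g \<circ> h \<in> SQS"
    using SQS_iff[OF homeo_pair_comp[OF gp(1) hp(1)]] SQS_bound_comp[OF hp(1) gp hp(2)] by blast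
  moreover have "AE x in lebesgue. (g \<circ> h) field_differentiable (at x) \<and> 0 < deriv (g \<circ> h) x"
    using ae by eventually_elim simp
  ultimately show ?thesis by (simp add: SS0_def)
qed

lemma SS0_inverse:
  assumes h: "h \<in> SS0" shows "\<exists>k\<in>SS0. k \<circ> h = id"
proof -
  obtain k D1 D2 K1 K2 where hp: "homeo_pair h k" "SQS_bound h D1 D2" "SQS_bound k K1 K2"
    using SS0_obtain[OF h] by metis
  have "AE y in lebesgue. h field_differentiable (at (k y)) \<and> 0 < deriv h (k y)"
    using AE_preimage[OF homeo_pair_sym[OF hp(1)] hp(2) SS0_derivative[OF h]] .
  then have ae: "AE y in lebesgue. k field_differentiable (at y) \<and> 0 < deriv k y
      \<and> - ln (deriv h (k y)) = ln (deriv k y)"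
  proof eventually_elim
    case (elim y)
    have "(k has_field_derivative inverse (deriv h (k y))) (at y)"
    proof (rule DERIV_inverse_function[where a = "y - 1" and b = "y + 1"])
      show "(h has_field_derivative deriv h (k y)) (at (k y))" using elim by (simp add: DERIV_deriv_iff_field_differentiable)
      show "isCont k y" using hp(1) by (simp add: homeo_pair_def continuous_on_eq_continuous_at)
    qed (use elim in \<open>auto simp: homeo_pair_inv[OF hp(1)]\<close>)
    then have "deriv k y = inverse (deriv h (k y))" "k field_differentiable (at y)"
      by (auto simp: DERIV_imp_deriv field_differentiable_def)
    then show ?case using elim by (simp add: ln_inverse)
  qed
  have "(\<lambda>y. ln (deriv h (k y))) \<in> CMO"
    using CMO_compose[OF homeo_pair_sym[OF hp(1)] hp(2) SS0_log_deriv[OF h]] .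
  then have "(\<lambda>y. - ln (deriv h (k y))) \<in> CMO" by (rule CMO_uminus)
  then have "(\<lambda>y. ln (deriv k y)) \<in> CMO"
    by (rule CMO_cong_AE[rotated]) (use ae in eventually_elim, simp)
  moreover have "k \<in> SQS" using SQS_iff[OF homeo_pair_sym[OF hp(1)]] hp(3) by blast
  moreover have "AE y in lebesgue. k field_differentiable (at y) \<and> 0 < deriv k y"
    using ae by eventually_elim simp
  moreover have "k \<circ> h = id" by (simp add: fun_eq_iff homeo_pair_inv[OF hp(1)])
  ultimately show ?thesis by (auto simp: SS0_def)
qed

theorem mainTheorem3:
  "group \<lparr>carrier = SS0, mult = (\<circ>), one = id\<rparr>"
  by (rule groupI) (auto simp: SS0_id SS0_comp SS0_inverse comp_assoc)

end
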